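(* Let $n=1$, so that the equation is the transport equation $w_t+\boldsymbol\omega\cdot\nabla w=0$ in $\mathbb{R}^d$ with a constant velocity $\boldsymbol\omega\in\mathbb{R}^d$. Let $X$ be a 1-periodic mesh and, for $h$ with $1/h\in\mathbb{N}$, let $X_h$ be the mesh obtained by scaling $X$ with coefficient $h$. On $\{X_h\}$ consider a $p$-exact ($p\in\mathbb{N}\cup\{0\}$) stable scheme $$\sum_{k\in\mathcal{S}(j)} m_{jk}\frac{du_k}{dt}+\sum_{k\in\mathcal{S}(j)}a_{jk}u_k=0,\qquad u_j(0)=(\Pi w_0)_j,\qquad j\in\mathcal{M},$$ of finite-volume form, i.e. $\sum_{k\in\mathcal S(j)}a_{jk}u_k=\frac{1}{|K_j|}\sum_{k\in N(j)}F_{jk}[u]$ with $F_{jk}[u]=-F_{kj}[u]$. If the scheme on $X$ does not have zero mean error on the $(p+1)$-th order polynomials, i.e. if $\sum_{j\in\mathcal{M}^1}|K_j|\,\epsilon_j(f,\Pi)\neq0$ for some $f\in P_{p+1}$, then there exists $\boldsymbol\alpha\in\mathbb{Z}^d$ such that for $w_0(\boldsymbol r)=\exp(2\pi i\,\boldsymbol\alpha\cdot\boldsymbol r)$ the following holds: for every $\delta>0$ and every $C>0$ the estimate $$\|\varepsilon(t)\|\le C\,h^{p+\delta}(1+t)$$ for the solution error on $X_h$ fails for some $h$ with $1/h\in\mathbb{N}$ and some $t>0$.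
   Context: Mesh. $\mathbb{R}^d$ is a union of non-overlapping control volumes $K_j$, $j\in\mathcal{M}$, of measure $|K_j|>0$, finitely many per unit cube, with associated points $\boldsymbol r_j$; the configuration is invariant under translations by integer vectors (1-periodic). $\mathcal{M}^1$ is the finite set of $j\in\mathcal M$ modulo integer translations. $N(j)$ is the set of $k\neq j$ such that $\partial K_j\cap\partial K_k$ has nonzero $(d-1)$-dimensional measure. $V_{per}\subset\mathbb{C}^{\mathcal{M}}$ is the space of mesh functions invariant under integer translations, with norm $\|f\|^2=\sum_{j\in\mathcal{M}^1}|K_j||f_j|^2$ (all taken for the mesh $X_h$ when working on $X_h$; $X_h$ is also 1-periodic). Scheme. $\Pi$ maps each continuous function either to its point values at $\boldsymbol r_j$ or to its averages over $K_j$ (the same choice on all $X_h$). The stencils $\mathcal{S}(j)$ are finite, $m_{jk},a_{jk}\in\mathbb{R}$, $\sum_k m_{jk}=1$; stencils, coefficients and fluxes are invariant under all translations preserving the mesh; $F_{jk}$ are linear and depend on finitely many $u_l$. Passing from $X$ to $X_h$ leaves $m_{jk}$ unchanged and multiplies $a_{jk}$ by $h^{-1}$. On each $X_h$ the scheme has a unique solution $u(t,f)\in V_{per}$ with $u(0,f)=f$ for each $f\in V_{per}$. Stability means that for each $t\ge0$ the quantity $K(t)=\sup_{0\le\tau\le t}\sup_{f\in V_{per}\setminus\{0\}}\|u(\tau,f)\|/\|f\|$ is bounded over the set $\{X_h\}$. Truncation error: $\epsilon_j(f,\Pi)=-\sum_{k\in\mathcal{S}(j)}m_{jk}(\Pi(\boldsymbol\omega\cdot\nabla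 f))_k+\sum_{k\in\mathcal{S}(j)}a_{jk}(\Pi f)_k$. $P_q$ is the space of polynomials in $d$ variables of degree at most $q$. The scheme is $p$-exact if $\epsilon_j(f,\Pi)=0$ for all $f\in P_p$, $j\in\mathcal{M}$. Solution error: $\varepsilon(t)=u(t,\Pi w_0)-\Pi w(t,\cdot)$, where $w(t,\boldsymbol r)=w_0(\boldsymbol r-\boldsymbol\omega t)$. *)

theory Defs
  imports "HOL-Analysis.Analysis"
begin

section \<open>Periodic meshes\<close>

text \<open>
  The index set of the mesh is the whole type \<open>'j\<close>; the dimension is \<open>CARD('d)\<close>.
\<close>

record ('j, 'd) mesh =
  cell :: "'j \<Rightarrow> (real ^ 'd) set"
  point :: "'j \<Rightarrow> real ^ 'd"

definition vol :: "('j, 'd::finite) mesh \<Rightarrow> 'j \<Rightarrow> real" where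
  "vol X j = measure lebesgue (cell X j)"

definition int_vectors :: "(real ^ 'd) set" where
  "int_vectors = {z. \<forall>i. z $ i \<in> \<int>}"

text \<open>
  \<open>translates X v \<sigma>\<close>: the translation by \<open>v\<close> preserves the mesh, and \<open>\<sigma>\<close> is the permutation of
  indices it induces. On a mesh in the sense of \<open>periodic_mesh\<close> below, \<open>\<sigma>\<close> is determined
  by \<open>v\<close>, because distinct indices have distinct cells.
\<close>

definition translates ::
  "('j, 'd::finite) mesh \<Rightarrow> real ^ 'd \<Rightarrow> ('j \<Rightarrow> 'j) \<Rightarrow> bool" where
  "translates X v \<sigma> \<longleftrightarrow>
     bij \<sigma> \<and>
     (\<forall>j. cell X (\<sigma> j) = (\<lambda>x. x + v) ` cell X j) \<and>
     (\<forall>j. point X (\<sigma> j) = point X j + v)"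

definition periodic_mesh :: "('j, 'd::finite) mesh \<Rightarrow> bool" where
  "periodic_mesh X \<longleftrightarrow>
     (\<Union>j. cell X j) = UNIV \<and>
     (\<forall>j. cell X j \<in> lmeasurable \<and> vol X j > 0) \<and>
     (\<forall>j k. j \<noteq> k \<longrightarrow> negligible (cell X j \<inter> cell X k)) \<and>
     (\<forall>a. finite {j. cell X j \<inter> cbox a (a + 1) \<noteq> {}}) \<and>
     (\<forall>z \<in> int_vectors. \<exists>\<sigma>. translates X z \<sigma>)"

definition index_equiv :: "('j, 'd::finite) mesh \<Rightarrow> ('j \<times> 'j) set" where
  "index_equiv X = {(j, k). \<exists>z \<in> int_vectors. \<exists>\<sigma>. translates X z \<sigma> \<and> k = \<sigma> j}"

text \<open>
  One representative of each class of indices modulo integer translations. The choice is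
  immaterial in the uses below: mesh functions in \<open>Vper X\<close> are periodic, and for a
  \<open>p\<close>-exact scheme so is the truncation error of a polynomial of degree at most \<open>p + 1\<close>.
\<close>

definition period_indices :: "('j, 'd::finite) mesh \<Rightarrow> 'j set" where
  "period_indices X = (\<lambda>c. SOME j. j \<in> c) ` (UNIV // index_equiv X)"

definition scale_mesh :: "real \<Rightarrow> ('j, 'd::finite) mesh \<Rightarrow> ('j, 'd) mesh" where
  "scale_mesh h X =
     \<lparr>cell = \<lambda>j. (\<lambda>x. h *\<^sub>R x) ` cell X j, point = \<lambda>j. h *\<^sub>R point X j\<rparr>"

definition scalings :: "real set" where
  "scalings = {h. 0 < h \<and> 1 / h \<in> \<nat>}"


section \<open>Neighbouring cells\<close>

text \<open>
  The \<open>s\<close>-dimensional Hausdorff outer measure, without normalising constant. For \<open>s = 0\<close> a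
  nonempty covering set contributes 1 (as \<open>0 ^ 0 = 1\<close>), so this is the counting measure.
\<close>

definition hausdorff_pre :: "nat \<Rightarrow> real \<Rightarrow> 'a::metric_space set \<Rightarrow> ennreal" where
  "hausdorff_pre s \<delta> A =
     (INF C \<in> {C :: nat \<Rightarrow> 'a set.
                A \<subseteq> (\<Union>i. C i) \<and> (\<forall>i. bounded (C i) \<and> diameter (C i) \<le> \<delta>)}.
        \<Sum>i. if C i = {} then 0 else ennreal (diameter (C i) ^ s))"

definition hausdorff_measure :: "nat \<Rightarrow> 'a::metric_space set \<Rightarrow> ennreal" where
  "hausdorff_measure s A = (SUP \<delta> \<in> {0<..}. hausdorff_pre s \<delta> A)"

definition neighbours :: "('j, 'd::finite) mesh \<Rightarrow> 'j \<Rightarrow> 'j set" where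
  "neighbours X j =
     {k. k \<noteq> j \<and>
         hausdorff_measure (CARD('d) - 1) (frontier (cell X j) \<inter> frontier (cell X k)) \<noteq> 0}"


section \<open>Mesh functions and their projections\<close>

definition Vper :: "('j, 'd::finite) mesh \<Rightarrow> ('j \<Rightarrow> complex) set" where
  "Vper X = {f. \<forall>z \<in> int_vectors. \<forall>\<sigma>. translates X z \<sigma> \<longrightarrow> (\<forall>j. f (\<sigma> j) = f j)}"

definition mesh_norm :: "('j, 'd::finite) mesh \<Rightarrow> ('j \<Rightarrow> complex) \<Rightarrow> real" where
  "mesh_norm X f = sqrt (\<Sum>j \<in> period_indices X. vol X j * (cmod (f j))\<^sup>2)"

datatype projection = Point_Values | Cell_Averages

fun proj ::
  "projection \<Rightarrow> ('j, 'd::finite) mesh \<Rightarrow> (real ^ 'd \<Rightarrow> complex) \<Rightarrow> 'j \<Rightarrow> complex" where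
  "proj Point_Values X f j = f (point X j)"
| "proj Cell_Averages X f j = integral (cell X j) f / of_real (vol X j)"

definition polys :: "nat \<Rightarrow> (real ^ 'd::finite \<Rightarrow> complex) set" where
  "polys q =
     {f. \<exists>c :: ('d \<Rightarrow> nat) \<Rightarrow> complex. \<forall>x.
          f x = (\<Sum>e | (\<Sum>i\<in>UNIV. e i) \<le> q. c e * of_real (\<Prod>i\<in>UNIV. (x $ i) ^ e i))}"


section \<open>Schemes\<close>

record 'j scheme =
  stencil :: "'j \<Rightarrow> 'j set"
  mcoef :: "'j \<Rightarrow> 'j \<Rightarrow> real"
  acoef :: "'j \<Rightarrow> 'j \<Rightarrow> real"

definition scale_scheme :: "real \<Rightarrow> 'j scheme \<Rightarrow> 'j scheme" where
  "scale_scheme h S = S\<lparr>acoef := \<lambda>j k. acoef S j k / h\<rparr>"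

definition admissible_scheme :: "('j, 'd::finite) mesh \<Rightarrow> 'j scheme \<Rightarrow> bool" where
  "admissible_scheme X S \<longleftrightarrow>
     (\<forall>j. finite (stencil S j) \<and> (\<Sum>k \<in> stencil S j. mcoef S j k) = 1) \<and>
     (\<forall>v \<sigma>. translates X v \<sigma> \<longrightarrow>
        (\<forall>j. stencil S (\<sigma> j) = \<sigma> ` stencil S j \<and>
             (\<forall>k \<in> stencil S j.
                mcoef S (\<sigma> j) (\<sigma> k) = mcoef S j k \<and> acoef S (\<sigma> j) (\<sigma> k) = acoef S j k)))"

definition linear_local :: "(('j \<Rightarrow> complex) \<Rightarrow> complex) \<Rightarrow> bool" where
  "linear_local L \<longleftrightarrow>
     (\<forall>u v. L (\<lambda>l. u l + v l) = L u + L v) \<and>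
     (\<forall>c u. L (\<lambda>l. c * u l) = c * L u) \<and>
     (\<exists>T. finite T \<and> (\<forall>u v. (\<forall>l \<in> T. u l = v l) \<longrightarrow> L u = L v))"

definition finite_volume_form ::
  "('j, 'd::finite) mesh \<Rightarrow> 'j scheme \<Rightarrow> ('j \<Rightarrow> 'j \<Rightarrow> ('j \<Rightarrow> complex) \<Rightarrow> complex) \<Rightarrow> bool" where
  "finite_volume_form X S F \<longleftrightarrow>
     (\<forall>j. \<forall>k \<in> neighbours X j.
        linear_local (F j k) \<and>
        (\<forall>u. F j k u = - F k j u) \<and>
        (\<forall>v \<sigma>. translates X v \<sigma> \<longrightarrow> (\<forall>u. F (\<sigma> j) (\<sigma> k) u = F j k (u \<circ> \<sigma>)))) \<and>
     (\<forall>j u. (\<Sum>k \<in> stencil S j. of_real (acoef S j k) * u k) =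
            (\<Sum>k \<in> neighbours X j. F j k u) / of_real (vol X j))"

text \<open>\<open>frechet_derivative f (at x) \<omega>\<close> is \<open>\<omega> \<cdot> \<nabla>f (x)\<close>.\<close>

definition trunc_error ::
  "projection \<Rightarrow> real ^ 'd::finite \<Rightarrow> ('j, 'd) mesh \<Rightarrow> 'j scheme \<Rightarrow>
     (real ^ 'd \<Rightarrow> complex) \<Rightarrow> 'j \<Rightarrow> complex" where
  "trunc_error P \<omega> X S f j =
     - (\<Sum>k \<in> stencil S j.
          of_real (mcoef S j k) * proj P X (\<lambda>x. frechet_derivative f (at x) \<omega>) k)
     + (\<Sum>k \<in> stencil S j. of_real (acoef S j k) * proj P X f k)"

definition p_exact ::
  "nat \<Rightarrow> projection \<Rightarrow> real ^ 'd::finite \<Rightarrow> ('j, 'd) mesh \<Rightarrow> 'j scheme \<Rightarrow> bool" where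
  "p_exact p P \<omega> X S \<longleftrightarrow> (\<forall>f \<in> polys p. \<forall>j. trunc_error P \<omega> X S f j = 0)"

definition zero_mean_error ::
  "nat \<Rightarrow> projection \<Rightarrow> real ^ 'd::finite \<Rightarrow> ('j, 'd) mesh \<Rightarrow> 'j scheme \<Rightarrow> bool" where
  "zero_mean_error q P \<omega> X S \<longleftrightarrow>
     (\<forall>f \<in> polys q.
        (\<Sum>j \<in> period_indices X. of_real (vol X j) * trunc_error P \<omega> X S f j) = 0)"


section \<open>Solutions and stability\<close>

definition is_solution ::
  "('j, 'd::finite) mesh \<Rightarrow> 'j scheme \<Rightarrow> ('j \<Rightarrow> complex) \<Rightarrow> (real \<Rightarrow> 'j \<Rightarrow> complex) \<Rightarrow> bool" where
  "is_solution X S f u \<longleftrightarrow>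
     u 0 = f \<and>
     (\<forall>t\<ge>0. u t \<in> Vper X) \<and>
     (\<exists>u'. \<forall>t\<ge>0.
        (\<forall>k. ((\<lambda>s. u s k) has_vector_derivative u' t k) (at t within {0..})) \<and>
        (\<forall>j. (\<Sum>k \<in> stencil S j. of_real (mcoef S j k) * u' t k) +
             (\<Sum>k \<in> stencil S j. of_real (acoef S j k) * u t k) = 0))"

definition uniquely_solvable :: "('j, 'd::finite) mesh \<Rightarrow> 'j scheme \<Rightarrow> bool" where
  "uniquely_solvable X S \<longleftrightarrow>
     (\<forall>f \<in> Vper X. \<exists>u. is_solution X S f u \<and>
        (\<forall>v. is_solution X S f v \<longrightarrow> (\<forall>t\<ge>0. v t = u t)))"

text \<open>
  Meaningful for \<open>f \<in> Vper X\<close> and \<open>t \<ge> 0\<close>, where the value does not depend on the choice if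
  \<open>uniquely_solvable X S\<close>; solutions are unconstrained at negative times.
\<close>

definition solution ::
  "('j, 'd::finite) mesh \<Rightarrow> 'j scheme \<Rightarrow> real \<Rightarrow> ('j \<Rightarrow> complex) \<Rightarrow> 'j \<Rightarrow> complex" where
  "solution X S t f = (SOME u. is_solution X S f u) t"

definition growth :: "('j, 'd::finite) mesh \<Rightarrow> 'j scheme \<Rightarrow> real \<Rightarrow> ennreal" where
  "growth X S t =
     (SUP \<tau> \<in> {0..t}. SUP f \<in> Vper X - {\<lambda>_. 0}.
        ennreal (mesh_norm X (solution X S \<tau> f) / mesh_norm X f))"

definition stable_family :: "('j, 'd::finite) mesh \<Rightarrow> 'j scheme \<Rightarrow> bool" where
  "stable_family X S \<longleftrightarrow>
     (\<forall>t\<ge>0. \<exists>C::real. \<forall>h \<in> scalings.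
        growth (scale_mesh h X) (scale_scheme h S) t \<le> ennreal C)"

definition sol_error ::
  "projection \<Rightarrow> real ^ 'd::finite \<Rightarrow> ('j, 'd) mesh \<Rightarrow> 'j scheme \<Rightarrow>
     (real ^ 'd \<Rightarrow> complex) \<Rightarrow> real \<Rightarrow> 'j \<Rightarrow> complex" where
  "sol_error P \<omega> X S w0 t j =
     solution X S t (proj P X w0) j - proj P X (\<lambda>x. w0 (x - t *\<^sub>R \<omega>)) j"

definition plane_wave :: "int ^ 'd::finite \<Rightarrow> real ^ 'd \<Rightarrow> complex" where
  "plane_wave \<alpha> x =
     exp (2 * of_real pi * \<i> * of_real (\<Sum>i\<in>UNIV. of_int (\<alpha> $ i) * x $ i))"

end

theory Submission
  imports Defs
begin

text \<open>
  A plane wave \<open>exp (2 \<pi> i \<alpha> \<cdot> x)\<close> on the mesh of size \<open>h\<close> is, in the coordinates of the unscaled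
  mesh \<open>X\<close>, a wave of frequency \<open>h \<alpha>\<close>, nearly constant over one period of \<open>X\<close>. Taylor expansion and
  \<open>p\<close>-exactness show that the mean of its truncation error over a period of \<open>X\<close> is
  \<open>c\<^sub>0 h ^ (p + 1) + O(h ^ (p + 2))\<close>, where \<open>c\<^sub>0\<close> is a multiple of the mean truncation error of
  \<open>(\<alpha> \<cdot> x) ^ (p + 1)\<close> (\<open>sum_trunc_error_plane_wave\<close>). Powers of integral linear forms span the
  homogeneous polynomials, so some \<open>\<alpha>\<close> makes \<open>c\<^sub>0\<close> nonzero (\<open>exists_wave_direction\<close>).

  A nonzero mean cannot be absorbed by a conservative scheme. The solution error \<open>e\<close> satisfies
  \<open>M e' + A e / h = - E T / h\<close>, where \<open>T\<close> is the truncation error and \<open>E\<close> a phase depending on time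
  only. By uniqueness, \<open>e\<close> is quasi-periodic with the multipliers of the wave
  (\<open>solution_quasiperiodic\<close>). This has two consequences. The mesh norm of \<open>e\<close> bounds its pointwise
  values uniformly in \<open>h\<close> (\<open>cmod_le_mesh_norm\<close>). And up to a relative error \<open>O(h)\<close> it is periodic on
  \<open>X\<close>, where the fluxes cancel (\<open>finite_volume_conservation\<close>), so that the mean of \<open>A e / h\<close> is
  bounded by the norm of \<open>e\<close> (\<open>flux_balance_of_quasiperiodic\<close>). Taking the mean over a period of \<open>X\<close>,
  removing the phase and integrating over the unit time interval leaves
  \<open>\<bar>mean T\<bar> / h \<le> K sup \<parallel>e\<parallel>\<close> (\<open>mean_truncation_error_bound\<close>). An error bound \<open>O(h ^ (p + \<delta>))\<close>
  on this interval would give \<open>\<bar>c\<^sub>0\<bar> \<le> O(h) + O(h powr \<delta>)\<close> for all \<open>h = 1 / N\<close>, which is absurd.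
\<close>

section \<open>Integrals and volumes of affine images\<close>

text \<open>
  Translating and scaling the mesh move both the cells and the integrals over them. This one
  change of variables gives the behaviour of cell averages and, with the integrand 1, of volumes.
  Boundedness reduces it to the affine substitution on a box.
\<close>

lemma has_integral_affine_image:
  fixes S :: "'a::euclidean_space set" and f :: "'a \<Rightarrow> 'b::banach"
  assumes "m > 0" "bounded S"
  shows "(f has_integral I) ((\<lambda>x. m *\<^sub>R x + c) ` S) \<longleftrightarrow>
         ((\<lambda>x. f (m *\<^sub>R x + c)) has_integral (I /\<^sub>R m ^ DIM('a))) S"
proof -
  let ?T = "\<lambda>x. m *\<^sub>R x + c"
  have "bounded (?T ` S)"
    using bounded_translation[OF bounded_scaling[OF assms(2), of m], of c]
    by (simp add: image_image add.commute)
  then obtain a b where ab: "?T ` S \<subseteq> cbox a b"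
    using bounded_subset_cbox_symmetric by metis
  let ?B = "cbox ((a - c) /\<^sub>R m) ((b - c) /\<^sub>R m)"
  have sub: "S \<subseteq> ?B"
  proof
    fix x assume "x \<in> S"
    then have "?T x \<in> cbox a b" using ab by auto
    then show "x \<in> ?B"
      using assms(1) by (auto simp: mem_box inner_simps field_simps)
  qed
  have inj: "?T x \<in> ?T ` S \<longleftrightarrow> x \<in> S" for x
    using assms(1) by auto
  have "(f has_integral I) (?T ` S) \<longleftrightarrow>
      ((\<lambda>x. if x \<in> ?T ` S then f x else 0) has_integral I) (cbox a b)"
    by (rule has_integral_restrict[OF ab, symmetric])
  also have "\<dots> \<longleftrightarrow> ((\<lambda>x. if ?T x \<in> ?T ` S then f (?T x) else 0) has_integral (I /\<^sub>R m ^ DIM('a))) ?B"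
    using has_integral_affinity_iff[OF assms(1), of "\<lambda>x. if x \<in> ?T ` S then f x else 0" c I a b] by simp
  also have "\<dots> \<longleftrightarrow> ((\<lambda>x. if x \<in> S then f (?T x) else 0) has_integral (I /\<^sub>R m ^ DIM('a))) ?B"
    by (simp only: inj)
  also have "\<dots> \<longleftrightarrow> ((\<lambda>x. f (?T x)) has_integral (I /\<^sub>R m ^ DIM('a))) S"
    by (rule has_integral_restrict[OF sub])
  finally show ?thesis .
qed

lemma integral_affine_image:
  fixes S :: "'a::euclidean_space set" and f :: "'a \<Rightarrow> 'b::banach"
  assumes "m > 0" "bounded S"
  shows "integral ((\<lambda>x. m *\<^sub>R x + c) ` S) f = m ^ DIM('a) *\<^sub>R integral S (\<lambda>x. f (m *\<^sub>R x + c))"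
proof (cases "f integrable_on ((\<lambda>x. m *\<^sub>R x + c) ` S)")
  case True
  then have "(f has_integral integral ((\<lambda>x. m *\<^sub>R x + c) ` S) f) ((\<lambda>x. m *\<^sub>R x + c) ` S)"
    by (rule integrable_integral)
  then have "((\<lambda>x. f (m *\<^sub>R x + c)) has_integral
      (integral ((\<lambda>x. m *\<^sub>R x + c) ` S) f /\<^sub>R m ^ DIM('a))) S"
    by (simp only: has_integral_affine_image[OF assms])
  then show ?thesis
    using assms(1) by (simp add: integral_unique)
next
  case False
  have "\<not> (\<lambda>x. f (m *\<^sub>R x + c)) integrable_on S"
  proof
    assume "(\<lambda>x. f (m *\<^sub>R x + c)) integrable_on S"
    then obtain J where "((\<lambda>x. f (m *\<^sub>R x + c)) has_integral J) S" by blast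
    then have "(f has_integral m ^ DIM('a) *\<^sub>R J) ((\<lambda>x. m *\<^sub>R x + c) ` S)"
      using assms(1) by (subst has_integral_affine_image[OF assms]) simp
    with False show False by blast
  qed
  with False show ?thesis by (simp add: not_integrable_integral)
qed

lemma lmeasurable_affine_image:
  fixes S :: "'a::euclidean_space set"
  assumes "m > 0" "bounded S" "S \<in> lmeasurable"
  shows "(\<lambda>x. m *\<^sub>R x + c) ` S \<in> lmeasurable"
proof -
  obtain J where J: "((\<lambda>x. 1::real) has_integral J) S"
    using assms(3) unfolding lmeasurable_iff_integrable_on by blast
  have "(m ^ DIM('a) *\<^sub>R J) /\<^sub>R m ^ DIM('a) = J" using assms(1) by simp
  then have "((\<lambda>x. 1::real) has_integral m ^ DIM('a) *\<^sub>R J) ((\<lambda>x. m *\<^sub>R x + c) ` S)"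
    using J has_integral_affine_image[OF assms(1,2), of "\<lambda>_. 1::real"] by metis
  then show ?thesis unfolding lmeasurable_iff_integrable_on by blast
qed

lemma measure_affine_image:
  fixes S :: "'a::euclidean_space set"
  assumes "m > 0" "bounded S" "S \<in> lmeasurable"
  shows "measure lebesgue ((\<lambda>x. m *\<^sub>R x + c) ` S) = m ^ DIM('a) * measure lebesgue S"
  unfolding lmeasure_integral[OF lmeasurable_affine_image[OF assms]] lmeasure_integral[OF assms(3)]
  unfolding integral_affine_image[OF assms(1,2)] by (rule real_scaleR_def)

section \<open>Translations of a mesh and boundedness of the cells\<close>

lemma int_vectors_0: "0 \<in> int_vectors"
  by (simp add: int_vectors_def)

lemma int_vectors_add: "x \<in> int_vectors \<Longrightarrow> y \<in> int_vectors \<Longrightarrow> x + y \<in> int_vectors"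
  by (simp add: int_vectors_def)

lemma int_vectors_uminus: "x \<in> int_vectors \<Longrightarrow> - x \<in> int_vectors"
  by (simp add: int_vectors_def)

lemma translates_point: "translates X v \<sigma> \<Longrightarrow> point X (\<sigma> j) = point X j + v"
  by (simp add: translates_def)

lemma translates_cell: "translates X v \<sigma> \<Longrightarrow> cell X (\<sigma> j) = (\<lambda>x. x + v) ` cell X j"
  by (simp add: translates_def)

lemma translates_bij: "translates X v \<sigma> \<Longrightarrow> bij \<sigma>"
  by (simp add: translates_def)

lemma translates_id: "translates X 0 (\<lambda>j. j)"
  using bij_id by (simp add: translates_def id_def)

lemma translates_comp:
  "translates X v \<sigma> \<Longrightarrow> translates X w \<tau> \<Longrightarrow> translates X (v + w) (\<tau> \<circ> \<sigma>)"
  by (auto simp: translates_def bij_comp image_image add.assoc)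

lemma translates_inv:
  assumes "translates X v \<sigma>"
  shows "translates X (- v) (inv \<sigma>)"
proof -
  have b: "bij \<sigma>" using assms by (simp add: translates_def)
  have e: "\<sigma> (inv \<sigma> j) = j" for j using b by (simp add: bij_is_surj surj_f_inv_f)
  have "cell X (inv \<sigma> j) = (\<lambda>x. x + - v) ` cell X j" "point X (inv \<sigma> j) = point X j + - v" for j
    using translates_cell[OF assms, of "inv \<sigma> j"] translates_point[OF assms, of "inv \<sigma> j"] e[of j]
    by (simp_all add: image_image)
  then show ?thesis
    using b bij_imp_bij_inv by (simp add: translates_def)
qed

text \<open>
  Together with \<open>translates_comp\<close> and \<open>translates_inv\<close> this makes the permutation a function of the translation vector:
  a nontrivial permutation would make two distinct cells coincide, so that a cell of positive
  volume would be negligible.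
\<close>

lemma translates_zero_unique:
  assumes "periodic_mesh X" "translates X 0 \<sigma>"
  shows "\<sigma> j = j"
proof (rule ccontr)
  assume "\<sigma> j \<noteq> j"
  then have "negligible (cell X (\<sigma> j) \<inter> cell X j)"
    using assms(1) by (simp add: periodic_mesh_def)
  moreover have "cell X (\<sigma> j) = cell X j" using assms(2) by (simp add: translates_def)
  ultimately have "negligible (cell X j)" by simp
  then have "vol X j = 0"
    by (simp add: vol_def negligible_imp_measure0)
  then show False using assms(1) by (metis periodic_mesh_def less_irrefl)
qed

lemma vol_pos: "periodic_mesh X \<Longrightarrow> vol X j > 0"
  by (simp add: periodic_mesh_def)

lemma cells_cover: "periodic_mesh X \<Longrightarrow> \<exists>j. x \<in> cell X j"
  unfolding periodic_mesh_def by (metis UNIV_I UN_E)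

lemma translates_ex:
  "periodic_mesh X \<Longrightarrow> z \<in> int_vectors \<Longrightarrow> \<exists>\<sigma>. translates X z \<sigma>"
  by (simp add: periodic_mesh_def)

text \<open>
  Local finiteness is assumed for unit cubes only; a bounded set has a finite cover by such cubes,
  by compactness of its closure.
\<close>

lemma finite_cells_meeting:
  assumes X: "periodic_mesh X" and B: "bounded B"
  shows "finite {j. cell X j \<inter> B \<noteq> {}}"
proof -
  define b where "b x = (box (x - (1/2) *\<^sub>R 1) (x + (1/2) *\<^sub>R 1) :: (real^'b) set)" for x
  have xb: "x \<in> b x" for x by (simp add: b_def mem_box_cart)
  have sub: "b x \<subseteq> cbox (x - (1/2) *\<^sub>R 1) (x - (1/2) *\<^sub>R 1 + 1)" for x
  proof
    fix y assume "y \<in> b x"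
    then have "x $ i - 1/2 < y $ i \<and> y $ i < x $ i + 1/2" for i by (auto simp: b_def mem_box_cart)
    then show "y \<in> cbox (x - (1/2) *\<^sub>R 1) (x - (1/2) *\<^sub>R 1 + 1)"
      by (auto simp: mem_box_cart) (smt (verit, best) field_sum_of_halves)+
  qed
  have "compact (closure B)" using B by (simp add: compact_closure)
  moreover have "closure B \<subseteq> \<Union> (range b)" using xb by auto
  moreover have "\<And>c. c \<in> range b \<Longrightarrow> open c" by (auto simp: b_def)
  ultimately obtain C where C: "C \<subseteq> range b" "finite C" "closure B \<subseteq> \<Union> C"
    by (rule compactE) blast
  obtain D where D: "finite D" "C = b ` D"
    using finite_subset_image[OF C(2,1)] by auto
  have "finite (\<Union>x\<in>D. {j. cell X j \<inter> cbox (x - (1/2) *\<^sub>R 1) (x - (1/2) *\<^sub>R 1 + 1) \<noteq> {}})"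
    using X D(1) by (simp add: periodic_mesh_def)
  moreover have "{j. cell X j \<inter> B \<noteq> {}} \<subseteq> (\<Union>x\<in>D. {j. cell X j \<inter> cbox (x - (1/2) *\<^sub>R 1) (x - (1/2) *\<^sub>R 1 + 1) \<noteq> {}})"
  proof
    fix j assume "j \<in> {j. cell X j \<inter> B \<noteq> {}}"
    then obtain y where y: "y \<in> cell X j" "y \<in> B" by auto
    then have "y \<in> closure B" using closure_subset by auto
    then obtain x where "x \<in> D" "y \<in> b x" using C(3) D(2) by auto
    then show "j \<in> (\<Union>x\<in>D. {j. cell X j \<inter> cbox (x - (1/2) *\<^sub>R 1) (x - (1/2) *\<^sub>R 1 + 1) \<noteq> {}})"
      using sub[of x] y by auto
  qed
  ultimately show ?thesis by (rule rev_finite_subset)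
qed

definition int_part :: "real ^ 'd \<Rightarrow> real ^ 'd" where
  "int_part x = (\<chi> i. of_int \<lfloor>x $ i\<rfloor>)"

lemma int_part_in: "int_part x \<in> int_vectors"
  by (simp add: int_part_def int_vectors_def)

lemma int_part_box: "x - int_part x \<in> cbox 0 (1 :: real ^ 'd::finite)"
  by (auto simp: int_part_def mem_box_cart) linarith

lemma translate_to_unit_cube:
  assumes X: "periodic_mesh (X :: ('j, 'd::finite) mesh)" and x: "x \<in> cell X j"
  obtains \<sigma> where "translates X (- int_part x) \<sigma>" "cell X (\<sigma> j) \<inter> cbox 0 1 \<noteq> {}"
proof -
  obtain \<sigma> where s: "translates X (- int_part x) \<sigma>"
    using translates_ex[OF X int_vectors_uminus[OF int_part_in]] by blast
  then have "x - int_part x \<in> cell X (\<sigma> j)"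
    using x by (auto simp: translates_cell)
  then show ?thesis using that[OF s] int_part_box[of x] by auto
qed

lemma finite_cells_meeting_unit_cube:
  "periodic_mesh (X :: ('j, 'd::finite) mesh) \<Longrightarrow> finite {j. cell X j \<inter> cbox 0 1 \<noteq> {}}"
  by (rule finite_cells_meeting) auto

text \<open>
  Every unit cube with integer corners that a cell meets can be translated to \<open>[0, 1]\<close>, and different translates of
  the cell have different indices. An unbounded cell would therefore supply infinitely many
  cells meeting \<open>[0, 1]\<close>.
\<close>

lemma bounded_cell:
  assumes X: "periodic_mesh (X :: ('j, 'd::finite) mesh)"
  shows "bounded (cell X j)"
proof -
  define Z where "Z = (\<lambda>k. point X j - point X k) ` {k. cell X k \<inter> cbox 0 1 \<noteq> {}}"
  have "finite Z" unfolding Z_def using finite_cells_meeting_unit_cube[OF X] by simp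
  moreover have "cell X j \<subseteq> (\<Union>z\<in>Z. (+) z ` cbox 0 1)"
  proof
    fix x assume x: "x \<in> cell X j"
    obtain \<sigma> where s: "translates X (- int_part x) \<sigma>" "cell X (\<sigma> j) \<inter> cbox 0 1 \<noteq> {}"
      using translate_to_unit_cube[OF X x] .
    have "int_part x = point X j - point X (\<sigma> j)" using translates_point[OF s(1), of j] by simp
    then have "int_part x \<in> Z" using s(2) by (auto simp: Z_def)
    moreover have "x = int_part x + (x - int_part x)" by simp
    ultimately show "x \<in> (\<Union>z\<in>Z. (+) z ` cbox 0 1)" using int_part_box[of x] by blast
  qed
  moreover have "bounded ((+) z ` cbox 0 (1 :: real ^ 'd))" for z
    by (simp add: bounded_translation)
  ultimately show ?thesis
    by (meson bounded_UN bounded_subset)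
qed

lemma cell_lmeasurable: "periodic_mesh X \<Longrightarrow> cell X j \<in> lmeasurable"
  by (simp add: periodic_mesh_def)

lemma cell_nonempty: "periodic_mesh X \<Longrightarrow> cell X j \<noteq> {}"
  using vol_pos[of X j] unfolding vol_def by force

lemma vol_translates:
  assumes "periodic_mesh X" "translates X v \<sigma>"
  shows "vol X (\<sigma> j) = vol X j"
  unfolding vol_def translates_cell[OF assms(2)]
  using measure_affine_image[OF zero_less_one bounded_cell[OF assms(1)] cell_lmeasurable[OF assms(1)], of v j]
  by simp

section \<open>Representatives modulo integer translations\<close>

lemma index_equivI:
  "z \<in> int_vectors \<Longrightarrow> translates X z \<sigma> \<Longrightarrow> k = \<sigma> j \<Longrightarrow> (j, k) \<in> index_equiv X"
  by (auto simp: index_equiv_def)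

lemma index_equivE:
  assumes "(j, k) \<in> index_equiv X"
  obtains z \<sigma> where "z \<in> int_vectors" "translates X z \<sigma>" "k = \<sigma> j"
  using assms by (auto simp: index_equiv_def)

lemma equiv_index_equiv: "equiv UNIV (index_equiv X)"
proof (rule equivI)
  show "index_equiv X \<subseteq> UNIV \<times> UNIV" by simp
  show "refl_on UNIV (index_equiv X)"
    by (rule refl_onI) (rule index_equivI[OF int_vectors_0 translates_id refl])
  show "sym (index_equiv X)"
  proof (rule symI)
    fix j k assume "(j, k) \<in> index_equiv X"
    then obtain z \<sigma> where z: "z \<in> int_vectors" "translates X z \<sigma>" "k = \<sigma> j"
      by (rule index_equivE)
    then have "j = inv \<sigma> k" using translates_bij[OF z(2)] by (simp add: bij_is_inj)
    with int_vectors_uminus[OF z(1)] translates_inv[OF z(2)]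
    show "(k, j) \<in> index_equiv X" by (rule index_equivI)
  qed
  show "trans (index_equiv X)"
  proof (rule transI)
    fix j k l assume jk: "(j, k) \<in> index_equiv X" and kl: "(k, l) \<in> index_equiv X"
    obtain z \<sigma> where z: "z \<in> int_vectors" "translates X z \<sigma>" "k = \<sigma> j"
      using jk by (rule index_equivE)
    obtain w \<tau> where w: "w \<in> int_vectors" "translates X w \<tau>" "l = \<tau> k"
      using kl by (rule index_equivE)
    show "(j, l) \<in> index_equiv X"
      using int_vectors_add[OF z(1) w(1)] translates_comp[OF z(2) w(2)]
      by (rule index_equivI) (simp add: z w)
  qed
qed

lemma period_indices_ex: "\<exists>k \<in> period_indices X. (j, k) \<in> index_equiv X"
proof -
  let ?c = "index_equiv X `` {j}"
  have "j \<in> ?c" by (rule equiv_class_self[OF equiv_index_equiv UNIV_I])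
  then have "(SOME k. k \<in> ?c) \<in> ?c" by (metis someI)
  moreover have "(SOME k. k \<in> ?c) \<in> period_indices X"
    unfolding period_indices_def by (rule imageI) (rule quotientI[OF UNIV_I])
  ultimately show ?thesis by blast
qed

lemma period_indices_unique:
  assumes "j \<in> period_indices X" "k \<in> period_indices X" "(j, k) \<in> index_equiv X"
  shows "j = k"
proof -
  obtain c where c: "c \<in> UNIV // index_equiv X" "j = (SOME i. i \<in> c)"
    using assms(1) by (auto simp: period_indices_def)
  obtain d where d: "d \<in> UNIV // index_equiv X" "k = (SOME i. i \<in> d)"
    using assms(2) by (auto simp: period_indices_def)
  have "j \<in> c" "k \<in> d"
    using c d equiv_index_equiv in_quotient_imp_non_empty by (metis some_in_eq)+
  then have "c = d" using quotient_eq_iff[OF equiv_index_equiv c(1) d(1)] assms(3) by blast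
  then show ?thesis using c d by simp
qed

lemma finite_period_indices:
  assumes X: "periodic_mesh (X :: ('j, 'd::finite) mesh)"
  shows "finite (period_indices X)"
proof -
  have "UNIV // index_equiv X \<subseteq> (\<lambda>k. index_equiv X `` {k}) ` {k. cell X k \<inter> cbox 0 1 \<noteq> {}}"
  proof
    fix c assume "c \<in> UNIV // index_equiv X"
    then obtain j where c: "c = index_equiv X `` {j}" by (auto simp: quotient_def)
    obtain x where x: "x \<in> cell X j" using cell_nonempty[OF X, of j] by auto
    obtain \<sigma> where s: "translates X (- int_part x) \<sigma>" "cell X (\<sigma> j) \<inter> cbox 0 1 \<noteq> {}"
      using translate_to_unit_cube[OF X x] .
    have "(j, \<sigma> j) \<in> index_equiv X"
      using int_vectors_uminus[OF int_part_in[of x]] s(1) refl by (rule index_equivI)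
    then have "c = index_equiv X `` {\<sigma> j}" using c equiv_class_eq[OF equiv_index_equiv] by metis
    then show "c \<in> (\<lambda>k. index_equiv X `` {k}) ` {k. cell X k \<inter> cbox 0 1 \<noteq> {}}" using s(2) by blast
  qed
  then have "finite (UNIV // index_equiv X)"
    using finite_cells_meeting_unit_cube[OF X] by (meson finite_imageI finite_subset)
  then show ?thesis by (simp add: period_indices_def)
qed

section \<open>Scaled meshes\<close>

text \<open>
  The scaled mesh is preserved by more translations than the integer ones: by all \<open>h\<close>-multiples of
  integer vectors. The argument uses this finer invariance.
\<close>

lemma translates_scale_mesh:
  assumes "h \<noteq> 0"
  shows "translates (scale_mesh h X) (h *\<^sub>R v) \<sigma> \<longleftrightarrow> translates X v \<sigma>"
proof -
  have i: "(\<lambda>x. x + h *\<^sub>R v) ` (\<lambda>x. h *\<^sub>R x) ` A = (\<lambda>x. h *\<^sub>R x) ` (\<lambda>x. x + v) ` A" for A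
    by (auto simp: image_image scaleR_add_right)
  have "inj ((*\<^sub>R) h :: real ^ 'b \<Rightarrow> _)" using assms by (simp add: inj_on_def)
  then show ?thesis
    using assms
    by (simp add: translates_def scale_mesh_def i inj_image_eq_iff flip: scaleR_add_right)
qed

lemma scalingsD: "h \<in> scalings \<Longrightarrow> h > 0" "h \<in> scalings \<Longrightarrow> h \<le> 1"
  "h \<in> scalings \<Longrightarrow> z \<in> int_vectors \<Longrightarrow> (1 / h) *\<^sub>R z \<in> int_vectors"
proof -
  show "h \<in> scalings \<Longrightarrow> h > 0" by (simp add: scalings_def)
  show "h \<le> 1" if h: "h \<in> scalings"
  proof -
    obtain n where n: "1 / h = real n" using h by (auto simp: scalings_def Nats_def)
    then have "n \<noteq> 0" using h by (cases "n = 0") (auto simp: scalings_def)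
    then have "1 / h \<ge> 1" using n by simp
    then show ?thesis using h by (auto simp: scalings_def field_simps)
  qed
  show "(1 / h) *\<^sub>R z \<in> int_vectors" if h: "h \<in> scalings" "z \<in> int_vectors"
  proof -
    have "1 / h \<in> \<int>" using h Nats_subset_Ints by (auto simp: scalings_def)
    then have "(1 / h) * z $ i \<in> \<int>" for i
      using h(2) unfolding int_vectors_def by (blast intro: Ints_mult)
    then show ?thesis by (simp add: int_vectors_def)
  qed
qed

lemma vol_scale_mesh:
  assumes "periodic_mesh (X :: ('j, 'd::finite) mesh)" "h > 0"
  shows "vol (scale_mesh h X) j = h ^ CARD('d) * vol X j"
  using measure_affine_image[OF assms(2) bounded_cell[OF assms(1)] cell_lmeasurable[OF assms(1)], of 0 j]
  by (simp add: vol_def scale_mesh_def)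

lemma periodic_scale_mesh:
  assumes X: "periodic_mesh (X :: ('j, 'd::finite) mesh)" and h: "h \<in> scalings"
  shows "periodic_mesh (scale_mesh h X)"
proof -
  have hp: "h > 0" using h scalingsD by auto
  have 1: "(\<Union>j. cell (scale_mesh h X) j) = UNIV"
  proof -
    have "x \<in> (\<Union>j. cell (scale_mesh h X) j)" for x
    proof -
      obtain j where "(1 / h) *\<^sub>R x \<in> cell X j" using cells_cover[OF X] by blast
      then have "x \<in> cell (scale_mesh h X) j"
        using hp by (auto simp: scale_mesh_def intro!: image_eqI[of _ _ "(1 / h) *\<^sub>R x"])
      then show ?thesis by blast
    qed
    then show ?thesis by blast
  qed
  have 2: "cell (scale_mesh h X) j \<in> lmeasurable \<and> vol (scale_mesh h X) j > 0" for j
    using lmeasurable_affine_image[OF hp bounded_cell[OF X] cell_lmeasurable[OF X], of 0 j]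
      vol_scale_mesh[OF X hp, of j] vol_pos[OF X, of j] hp by (simp add: scale_mesh_def)
  have 3: "negligible (cell (scale_mesh h X) j \<inter> cell (scale_mesh h X) k)" if "j \<noteq> k" for j k
  proof -
    have "cell (scale_mesh h X) j \<inter> cell (scale_mesh h X) k = (\<lambda>x. h *\<^sub>R x) ` (cell X j \<inter> cell X k)"
      using hp by (auto simp: scale_mesh_def)
    moreover have "negligible (cell X j \<inter> cell X k)" using X that by (simp add: periodic_mesh_def)
    moreover have "bounded (cell X j \<inter> cell X k)" using bounded_cell[OF X] bounded_Int by blast
    ultimately show ?thesis
      using measure_affine_image[OF hp, of "cell X j \<inter> cell X k" 0]
        lmeasurable_affine_image[OF hp, of "cell X j \<inter> cell X k" 0]
      by (simp add: negligible_iff_measure)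
  qed
  have 4: "finite {j. cell (scale_mesh h X) j \<inter> cbox a (a + 1) \<noteq> {}}" for a
  proof -
    have "{j. cell (scale_mesh h X) j \<inter> cbox a (a + 1) \<noteq> {}} \<subseteq>
      {j. cell X j \<inter> (\<lambda>x. (1/h) *\<^sub>R x) ` cbox a (a + 1) \<noteq> {}}"
    proof
      fix j assume "j \<in> {j. cell (scale_mesh h X) j \<inter> cbox a (a + 1) \<noteq> {}}"
      then obtain x where "x \<in> cell X j" "h *\<^sub>R x \<in> cbox a (a + 1)"
        by (auto simp: scale_mesh_def)
      moreover have "x = (1 / h) *\<^sub>R (h *\<^sub>R x)" using hp by simp
      ultimately show "j \<in> {j. cell X j \<inter> (\<lambda>x. (1/h) *\<^sub>R x) ` cbox a (a + 1) \<noteq> {}}"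
        by blast
    qed
    moreover have "bounded ((\<lambda>x. (1/h) *\<^sub>R x) ` cbox a (a + 1 :: real ^ 'd))"
      by (intro bounded_scaling) auto
    ultimately show ?thesis
      using finite_cells_meeting[OF X] finite_subset by blast
  qed
  have 5: "\<exists>\<sigma>. translates (scale_mesh h X) z \<sigma>" if z: "z \<in> int_vectors" for z
  proof -
    obtain \<sigma> where "translates X ((1 / h) *\<^sub>R z) \<sigma>"
      using translates_ex[OF X scalingsD(3)[OF h z]] by blast
    then have "translates (scale_mesh h X) (h *\<^sub>R ((1 / h) *\<^sub>R z)) \<sigma>"
      using hp translates_scale_mesh[of h] by blast
    then show ?thesis using hp by auto
  qed
  show ?thesis using 1 2 3 4 5 by (simp add: periodic_mesh_def)
qed

section \<open>Translation invariance of the neighbour relation\<close>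

lemma diameter_translate:
  fixes A :: "'a::real_normed_vector set"
  shows "diameter ((\<lambda>x. x + v) ` A) = diameter A"
proof -
  have "(\<lambda>x. x + v) ` A \<times> (\<lambda>x. x + v) ` A = (\<lambda>(x, y). (x + v, y + v)) ` (A \<times> A)"
    by force
  then show ?thesis by (simp add: diameter_def image_image case_prod_beta dist_norm)
qed

lemma hausdorff_pre_translate_le:
  fixes A :: "'a::real_normed_vector set"
  shows "hausdorff_pre s \<delta> ((\<lambda>x. x + v) ` A) \<le> hausdorff_pre s \<delta> A"
  unfolding hausdorff_pre_def
proof (rule INF_greatest)
  fix C :: "nat \<Rightarrow> 'a set"
  assume C: "C \<in> {C. A \<subseteq> (\<Union>i. C i) \<and> (\<forall>i. bounded (C i) \<and> diameter (C i) \<le> \<delta>)}"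
  let ?D = "\<lambda>i. (\<lambda>x. x + v) ` C i"
  have b: "bounded (?D i)" for i
    using C bounded_translation[of "C i" v] by (simp add: add.commute)
  have c: "(\<lambda>x. x + v) ` A \<subseteq> (\<Union>i. ?D i)" using C by blast
  have D: "?D \<in> {C. (\<lambda>x. x + v) ` A \<subseteq> (\<Union>i. C i) \<and> (\<forall>i. bounded (C i) \<and> diameter (C i) \<le> \<delta>)}"
    using C b c by (simp add: diameter_translate)
  show "(INF C \<in> {C. (\<lambda>x. x + v) ` A \<subseteq> (\<Union>i. C i) \<and> (\<forall>i. bounded (C i) \<and> diameter (C i) \<le> \<delta>)}.
          \<Sum>i. if C i = {} then 0 else ennreal (diameter (C i) ^ s))
        \<le> (\<Sum>i. if C i = {} then 0 else ennreal (diameter (C i) ^ s))"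
    using INF_lower[OF D, of "\<lambda>C. \<Sum>i. if C i = {} then 0 else ennreal (diameter (C i) ^ s)"]
    by (simp add: diameter_translate cong: if_cong)
qed

text \<open>
  Needed because the fluxes are known to be translation invariant and antisymmetric only between
  neighbours.
\<close>

lemma hausdorff_measure_translate:
  fixes A :: "'a::real_normed_vector set"
  shows "hausdorff_measure s ((\<lambda>x. x + v) ` A) = hausdorff_measure s A"
proof -
  have "hausdorff_pre s \<delta> ((\<lambda>x. x + v) ` A) = hausdorff_pre s \<delta> A" for \<delta>
    using hausdorff_pre_translate_le[of s \<delta> v A]
      hausdorff_pre_translate_le[of s \<delta> "- v" "(\<lambda>x. x + v) ` A"]
    by (simp add: image_image)
  then show ?thesis by (simp add: hausdorff_measure_def)
qed

lemma hausdorff_measure_empty: "hausdorff_measure s ({} :: 'a::metric_space set) = 0"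
proof -
  have "hausdorff_pre s \<delta> ({} :: 'a set) = 0" if "\<delta> > 0" for \<delta>
  proof -
    have "(\<lambda>i::nat. {}) \<in> {C :: nat \<Rightarrow> 'a set. {} \<subseteq> (\<Union>i. C i) \<and> (\<forall>i. bounded (C i) \<and> diameter (C i) \<le> \<delta>)}"
      using that by simp
    from INF_lower[OF this, of "\<lambda>C. \<Sum>i. if C i = {} then 0 else ennreal (diameter (C i) ^ s)"]
    show ?thesis unfolding hausdorff_pre_def by simp
  qed
  then have "hausdorff_measure s ({} :: 'a set) = (SUP \<delta>\<in>{0::real<..}. 0)"
    unfolding hausdorff_measure_def by (intro SUP_cong) auto
  then show ?thesis by simp
qed

lemma neighbours_sym: "k \<in> neighbours X j \<longleftrightarrow> j \<in> neighbours X k"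
  by (auto simp: neighbours_def Int_commute)

lemma neighbours_translates:
  assumes s: "translates X v \<sigma>" and k: "k \<in> neighbours X j"
  shows "\<sigma> k \<in> neighbours X (\<sigma> j)"
proof -
  have f: "frontier (cell X (\<sigma> i)) = (\<lambda>x. x + v) ` frontier (cell X i)" for i
    unfolding translates_cell[OF s] using frontier_translation[of v "cell X i"]
    by (simp add: add.commute)
  have "inj (\<lambda>x. x + v)" by (simp add: inj_on_def)
  then have "frontier (cell X (\<sigma> j)) \<inter> frontier (cell X (\<sigma> k)) =
        (\<lambda>x. x + v) ` (frontier (cell X j) \<inter> frontier (cell X k))"
    unfolding f by (simp add: image_Int)
  moreover have "\<sigma> k \<noteq> \<sigma> j"
    using k translates_bij[OF s] by (auto simp: neighbours_def dest: bij_is_inj injD)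
  ultimately show ?thesis
    using k by (simp add: neighbours_def hausdorff_measure_translate)
qed

text \<open>
  Neighbours of a cell meet the 1-neighbourhood of its frontier, which is bounded. Without
  finiteness the sum over the neighbours would degenerate to 0.
\<close>

lemma finite_neighbours:
  assumes X: "periodic_mesh (X :: ('j, 'd::finite) mesh)"
  shows "finite (neighbours X j)"
proof -
  define B where "B = (\<Union>x\<in>frontier (cell X j). \<Union>y\<in>ball 0 1. {x + y})"
  have "bounded (frontier (cell X j))"
    using bounded_cell[OF X] bounded_closure bounded_subset Diff_subset unfolding frontier_def by metis
  then have B: "bounded B" unfolding B_def by (rule bounded_sums) simp
  have "neighbours X j \<subseteq> {k. cell X k \<inter> B \<noteq> {}}"
  proof
    fix k assume "k \<in> neighbours X j"
    then have "frontier (cell X j) \<inter> frontier (cell X k) \<noteq> {}"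
      by (auto simp: neighbours_def hausdorff_measure_empty)
    then obtain x where x: "x \<in> frontier (cell X j)" "x \<in> closure (cell X k)"
      by (auto simp: frontier_def)
    then obtain y where y: "y \<in> cell X k" "dist y x < 1"
      using closure_approachable[of x "cell X k"] zero_less_one by blast
    then have "y = x + (y - x)" "y - x \<in> ball 0 1" by (auto simp: dist_norm norm_minus_commute)
    then have "y \<in> B" using x(1) unfolding B_def by blast
    then show "k \<in> {k. cell X k \<inter> B \<noteq> {}}" using y by blast
  qed
  then show ?thesis using finite_cells_meeting[OF X B] finite_subset by blast
qed

section \<open>Conservation\<close>

lemma translate_to_representative:
  "\<exists>\<sigma>. (\<exists>z\<in>int_vectors. translates X z \<sigma>) \<and> \<sigma> j \<in> period_indices X"
  using period_indices_ex[of X j] by (auto elim!: index_equivE)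

text \<open>
  Discrete conservation on the torus. Each face carries two opposite fluxes, but summing over
  representatives \<open>j\<close> sees the face from \<open>(j, l)\<close>, where \<open>l\<close> need not be a representative.
  Translating \<open>l\<close> into the set of representatives and swapping the two cells is an involution on
  the pairs in question, under which the flux of a periodic function changes sign; hence the total
  equals its own negative.
\<close>

lemma finite_volume_conservation:
  assumes X: "periodic_mesh (X :: ('j, 'd::finite) mesh)"
    and fv: "finite_volume_form X S F" and v: "v \<in> Vper X"
  shows "(\<Sum>j\<in>period_indices X. of_real (vol X j) * (\<Sum>k\<in>stencil S j. of_real (acoef S j k) * v k)) = 0"
proof -
  let ?R = "period_indices X"
  define \<sigma> where "\<sigma> l = (SOME \<sigma>. (\<exists>z\<in>int_vectors. translates X z \<sigma>) \<and> \<sigma> l \<in> ?R)" for l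
  have \<sigma>: "(\<exists>z\<in>int_vectors. translates X z (\<sigma> l)) \<and> \<sigma> l l \<in> ?R" for l
    unfolding \<sigma>_def by (rule someI_ex[OF translate_to_representative])
  define D where "D = Sigma ?R (neighbours X)"
  define \<phi> where "\<phi> = (\<lambda>(j, l). (\<sigma> l l, \<sigma> l j))"
  define G where "G = (\<lambda>(j, l). F j l v)"
  have anti: "F j l v = - F l j v" if "l \<in> neighbours X j" for j l
    using fv that unfolding finite_volume_form_def by blast
  have shift: "F (\<tau> j) (\<tau> l) v = F j l v"
    if "l \<in> neighbours X j" "z \<in> int_vectors" "translates X z \<tau>" for j l z \<tau>
  proof -
    have "v \<circ> \<tau> = v" using v that by (auto simp: Vper_def)
    moreover have "F (\<tau> j) (\<tau> l) v = F j l (v \<circ> \<tau>)"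
      using fv that unfolding finite_volume_form_def by blast
    ultimately show ?thesis by simp
  qed
  have "sum G D = sum (\<lambda>x. - G x) D"
  proof (rule sum.reindex_bij_witness[of _ \<phi> \<phi>])
    fix x assume x: "x \<in> D"
    obtain j l where jl: "x = (j, l)" "j \<in> ?R" "l \<in> neighbours X j" using x by (auto simp: D_def)
    obtain z where z: "z \<in> int_vectors" "translates X z (\<sigma> l)" using \<sigma> by blast
    let ?k = "\<sigma> l j"
    obtain z' where z': "z' \<in> int_vectors" "translates X z' (\<sigma> ?k)" using \<sigma> by blast
    have c: "translates X (z + z') (\<sigma> ?k \<circ> \<sigma> l)" by (rule translates_comp[OF z(2) z'(2)])
    have e: "j = \<sigma> ?k (\<sigma> l j)"
      using jl(2) conjunct2[OF \<sigma>[of ?k]]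
      by (rule period_indices_unique) (rule index_equivI[OF int_vectors_add[OF z(1) z'(1)] c], simp)
    then have "z + z' = 0" using translates_point[OF c, of j] by simp
    then have "(\<sigma> ?k \<circ> \<sigma> l) i = i" for i using translates_zero_unique[OF X] c by metis
    then show "\<phi> (\<phi> x) = x" by (simp add: \<phi>_def jl(1))
    show "\<phi> x \<in> D"
      using \<sigma>[of l] neighbours_translates[OF z(2)] jl(3) neighbours_sym[of l X j]
      by (simp add: \<phi>_def jl(1) D_def)
    show "- G (\<phi> x) = G x"
      using shift[OF _ z, of j l] anti[OF jl(3)] jl(3) neighbours_sym[of l X j] shift[OF _ z, of l j]
      by (simp add: \<phi>_def G_def jl(1))
    show "\<phi> (\<phi> x) = x" by fact
    show "\<phi> x \<in> D" by fact
  qed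
  then have "sum G D = - sum G D" by (simp add: sum_negf)
  then have "sum G D = 0" by simp
  moreover have "sum G D = (\<Sum>j\<in>?R. \<Sum>l\<in>neighbours X j. F j l v)"
    unfolding D_def G_def using finite_period_indices[OF X] finite_neighbours[OF X]
    by (simp add: sum.Sigma)
  moreover have "of_real (vol X j) * (\<Sum>k\<in>stencil S j. of_real (acoef S j k) * v k) =
      (\<Sum>l\<in>neighbours X j. F j l v)" for j
    using fv vol_pos[OF X, of j] by (simp add: finite_volume_form_def)
  ultimately show ?thesis by simp
qed

section \<open>Pointwise control by the mesh norm\<close>

text \<open>
  A period of the mesh scaled by \<open>h = 1 / N\<close> contains \<open>N ^ CARD('d)\<close> translates of each cell of
  \<open>X\<close>, and the scaled volume is smaller by exactly this factor. So if the modulus of \<open>g\<close> is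
  \<open>X\<close>-periodic, the scaled norm bounds every single value, with a constant independent of \<open>h\<close>;
  for a general mesh function a negative power of \<open>h\<close> would be lost.
\<close>

lemma cmod_le_mesh_norm:
  fixes X :: "('j, 'd::finite) mesh"
  assumes X: "periodic_mesh X" and h: "h \<in> scalings"
    and g: "\<And>z \<sigma> j. z \<in> int_vectors \<Longrightarrow> translates X z \<sigma> \<Longrightarrow> cmod (g (\<sigma> j)) = cmod (g j)"
  shows "vol X j * (cmod (g j))\<^sup>2 \<le> (mesh_norm (scale_mesh h X) g)\<^sup>2"
proof -
  let ?Y = "scale_mesh h X"
  let ?R = "period_indices ?Y"
  have hp: "h > 0" using scalingsD h by blast
  have Y: "periodic_mesh ?Y" by (rule periodic_scale_mesh[OF X h])
  obtain N where N: "1 / h = real N" using h by (auto simp: scalings_def Nats_def)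
  then have hN: "real N * h = 1" using hp by (simp add: field_simps)
  \<comment> \<open>One index for each cube of side \<open>h\<close> in the unit cube.\<close>
  define B where "B = PiE (UNIV :: 'd set) (\<lambda>_. {..<N})"
  define zv where "zv b = (\<chi> i. real (b i) :: real ^ 'd)" for b :: "'d \<Rightarrow> nat"
  have zv: "zv b \<in> int_vectors" for b by (simp add: zv_def int_vectors_def)
  obtain \<sigma> where \<sigma>: "\<And>b. translates X (zv b) (\<sigma> b)"
    using translates_ex[OF X zv] by metis
  define rep where "rep b = (SOME k. k \<in> ?R \<and> (\<sigma> b j, k) \<in> index_equiv ?Y)" for b
  have "rep b \<in> ?R \<and> (\<sigma> b j, rep b) \<in> index_equiv ?Y" for b
    unfolding rep_def by (rule someI_ex) (use period_indices_ex[of ?Y "\<sigma> b j"] in blast)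
  then have rep: "rep b \<in> ?R" "(\<sigma> b j, rep b) \<in> index_equiv ?Y" for b by auto
  have inj: "inj_on rep B"
  proof (rule inj_onI)
    fix b c assume b: "b \<in> B" and c: "c \<in> B" and bc: "rep b = rep c"
    have "(\<sigma> b j, \<sigma> c j) \<in> index_equiv ?Y"
      using rep(2)[of b] rep(2)[of c] bc equiv_index_equiv[of ?Y]
      by (metis equivE symD transD)
    then obtain z \<tau> where z: "z \<in> int_vectors" "translates ?Y z \<tau>" "\<sigma> c j = \<tau> (\<sigma> b j)"
      by (rule index_equivE)
    have "point ?Y (\<sigma> c j) = point ?Y (\<sigma> b j) + z" using translates_point[OF z(2)] z(3) by simp
    then have "h *\<^sub>R zv c = h *\<^sub>R zv b + z"
      using translates_point[OF \<sigma>] by (simp add: scale_mesh_def scaleR_add_right)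
    then have hz: "h * real (c i) = h * real (b i) + z $ i" for i
      by (auto simp: vec_eq_iff zv_def)
    have "b i = c i" for i
    proof -
      obtain m where m: "z $ i = of_int m" using z(1) by (auto simp: int_vectors_def Ints_def)
      have "real N * (h * real (c i)) = real N * (h * real (b i)) + real N * of_int m"
        using hz[of i] m by (simp add: algebra_simps)
      then have "real (c i) = real (b i) + real N * of_int m"
        using hN by (metis mult.assoc mult_1)
      then have "real_of_int (int (c i)) = real_of_int (int (b i) + int N * m)" by simp
      then have cb: "int (c i) = int (b i) + int N * m" by (simp only: of_int_eq_iff)
      then have "int (c i) mod int N = int (b i) mod int N" by simp
      moreover have "c i < N" "b i < N" using b c by (auto simp: B_def PiE_def Pi_def)
      ultimately show ?thesis by simp
    qed
    then show "b = c" by auto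
  qed
  have val: "vol ?Y (rep b) * (cmod (g (rep b)))\<^sup>2 = h ^ CARD('d) * (vol X j * (cmod (g j))\<^sup>2)" for b
  proof -
    obtain z \<tau> where z: "z \<in> int_vectors" "translates ?Y z \<tau>" "rep b = \<tau> (\<sigma> b j)"
      using rep(2)[of b] by (rule index_equivE)
    have "translates ?Y (h *\<^sub>R ((1 / h) *\<^sub>R z)) \<tau>" using z(2) hp by simp
    then have \<tau>: "translates X ((1 / h) *\<^sub>R z) \<tau>"
      using translates_scale_mesh[of h X "(1 / h) *\<^sub>R z" \<tau>] hp by blast
    have "vol X (rep b) = vol X j" using vol_translates[OF X \<tau>] vol_translates[OF X \<sigma>] z(3) by simp
    moreover have "cmod (g (rep b)) = cmod (g j)"
      using g[OF scalingsD(3)[OF h z(1)] \<tau>] g[OF zv \<sigma>] z(3) by simp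
    ultimately show ?thesis by (simp add: vol_scale_mesh[OF X hp])
  qed
  have "card B = N ^ CARD('d)" by (simp add: B_def card_PiE)
  then have "vol X j * (cmod (g j))\<^sup>2 = (\<Sum>b\<in>B. vol ?Y (rep b) * (cmod (g (rep b)))\<^sup>2)"
    using hN by (simp add: val power_mult_distrib[symmetric] mult.assoc[symmetric])
  also have "\<dots> = (\<Sum>k\<in>rep ` B. vol ?Y k * (cmod (g k))\<^sup>2)"
    by (simp add: sum.reindex[OF inj])
  also have "\<dots> \<le> (\<Sum>k\<in>?R. vol ?Y k * (cmod (g k))\<^sup>2)"
    using rep(1) less_imp_le[OF vol_pos[OF Y]]
    by (intro sum_mono2 finite_period_indices[OF Y]) auto
  also have "\<dots> = (mesh_norm ?Y g)\<^sup>2"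
    unfolding mesh_norm_def using less_imp_le[OF vol_pos[OF Y]]
    by (subst real_sqrt_pow2) (auto intro!: sum_nonneg)
  finally show ?thesis .
qed

section \<open>Projections onto the mesh\<close>

lemma continuous_integrable_on_cell:
  fixes f :: "real ^ 'd::finite \<Rightarrow> complex"
  assumes X: "periodic_mesh X" and f: "continuous_on UNIV f"
  shows "f integrable_on cell X j"
proof -
  obtain a b where ab: "cell X j \<subseteq> cbox a b"
    using bounded_cell[OF X] bounded_subset_cbox_symmetric by metis
  have "f absolutely_integrable_on cbox a b"
    by (intro absolutely_integrable_continuous continuous_on_subset[OF f]) simp
  then have "f absolutely_integrable_on cell X j"
    by (rule set_integrable_subset) (use ab cell_lmeasurable[OF X, of j] in auto)
  then show ?thesis using set_lebesgue_integral_eq_integral(1) by blast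
qed

lemma proj_add:
  assumes X: "periodic_mesh X" and f: "continuous_on UNIV f" and g: "continuous_on UNIV g"
  shows "proj P X (\<lambda>x. f x + g x) j = proj P X f j + proj P X g j"
  using continuous_integrable_on_cell[OF X f] continuous_integrable_on_cell[OF X g]
  by (cases P) (simp_all add: integral_add add_divide_distrib)

lemma proj_cmult: "proj P X (\<lambda>x. c * f x) j = c * proj P X f j"
  by (cases P) simp_all

lemma cmod_proj_le:
  assumes X: "periodic_mesh X" and f: "continuous_on UNIV f"
    and B: "\<And>x. x \<in> insert (point X j) (cell X j) \<Longrightarrow> cmod (f x) \<le> B"
  shows "cmod (proj P X f j) \<le> B"
proof (cases P)
  case Point_Values
  then show ?thesis using B by simp
next
  case Cell_Averages
  have one: "(\<lambda>x. 1 :: real) integrable_on cell X j"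
    using cell_lmeasurable[OF X, of j] by (simp only: lmeasurable_iff_integrable_on)
  have "(\<lambda>x. B *\<^sub>R (1::real)) integrable_on cell X j" by (rule integrable_cmul[OF one])
  then have "(\<lambda>x. B) integrable_on cell X j" by simp
  then have "cmod (integral (cell X j) f) \<le> integral (cell X j) (\<lambda>_. B)"
    using B by (intro integral_norm_bound_integral continuous_integrable_on_cell[OF X f]) auto
  also have "integral (cell X j) (\<lambda>_. B) = integral (cell X j) (\<lambda>_. B *\<^sub>R (1::real))"
    by simp
  also have "\<dots> = B *\<^sub>R integral (cell X j) (\<lambda>_. 1::real)"
    by (rule integral_cmul)
  also have "\<dots> = B * vol X j"
    unfolding vol_def lmeasure_integral[OF cell_lmeasurable[OF X]] by (rule real_scaleR_def)
  finally show ?thesis using Cell_Averages vol_pos[OF X, of j] by (simp add: norm_divide divide_le_eq)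
qed

lemma proj_translates:
  fixes X :: "('j, 'd::finite) mesh"
  assumes X: "periodic_mesh X" and s: "translates X v \<sigma>"
  shows "proj P X f (\<sigma> j) = proj P X (\<lambda>x. f (x + v)) j"
proof (cases P)
  case Cell_Averages
  have "integral ((\<lambda>x. 1 *\<^sub>R x + v) ` cell X j) f = 1 ^ DIM(real ^ 'd) *\<^sub>R integral (cell X j) (\<lambda>x. f (1 *\<^sub>R x + v))"
    by (rule integral_affine_image[OF zero_less_one bounded_cell[OF X]])
  then show ?thesis
    using Cell_Averages vol_translates[OF X s, of j] translates_cell[OF s, of j] by simp
qed (simp add: translates_point[OF s])

lemma proj_scale_mesh:
  fixes X :: "('j, 'd::finite) mesh"
  assumes X: "periodic_mesh X" and h: "h > 0"
  shows "proj P (scale_mesh h X) f j = proj P X (\<lambda>x. f (h *\<^sub>R x)) j"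
proof (cases P)
  case Cell_Averages
  have "integral ((\<lambda>x. h *\<^sub>R x + 0) ` cell X j) f = h ^ DIM(real ^ 'd) *\<^sub>R integral (cell X j) (\<lambda>x. f (h *\<^sub>R x + 0))"
    by (rule integral_affine_image[OF h bounded_cell[OF X]])
  then show ?thesis
    using Cell_Averages vol_scale_mesh[OF X h, of j] h
    by (simp add: scale_mesh_def scaleR_conv_of_real)
qed (simp add: scale_mesh_def)

section \<open>Linear functionals and the truncation error\<close>

text \<open>
  The functions on which the truncation error is linear: both the function and its derivative along
  \<open>\<omega>\<close> must have well-defined cell averages.
\<close>

definition C1_along :: "real ^ 'd::finite \<Rightarrow> (real ^ 'd \<Rightarrow> complex) set" where
  "C1_along \<omega> = {f. (\<forall>x. f differentiable at x) \<and>
                     continuous_on UNIV (\<lambda>x. frechet_derivative f (at x) \<omega>)}"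

lemma C1_alongI:
  assumes "\<And>x. (f has_derivative D x) (at x)" "continuous_on UNIV (\<lambda>x. D x \<omega>)"
  shows "f \<in> C1_along \<omega>" "frechet_derivative f (at x) \<omega> = D x \<omega>"
proof -
  have e: "frechet_derivative f (at x) = D x" for x
    using frechet_derivative_at[OF assms(1)] by simp
  then show "frechet_derivative f (at x) \<omega> = D x \<omega>" by simp
  show "f \<in> C1_along \<omega>"
    using assms e by (auto simp: C1_along_def differentiable_def)
qed

lemma C1_alongD:
  assumes "f \<in> C1_along \<omega>"
  shows "(f has_derivative frechet_derivative f (at x)) (at x)"
    "continuous_on UNIV (\<lambda>x. frechet_derivative f (at x) \<omega>)" "continuous_on UNIV f"
  using assms frechet_derivative_works[of f "at x"]
  by (auto simp: C1_along_def intro!: differentiable_imp_continuous_on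
      simp: differentiable_on_def differentiable_at_withinI)

lemma C1_along_const: "(\<lambda>x. c) \<in> C1_along \<omega>"
  by (rule C1_alongI(1)[where D = "\<lambda>_ _. 0"]) auto

lemma C1_along_add:
  assumes "f \<in> C1_along \<omega>" "g \<in> C1_along \<omega>"
  shows "(\<lambda>x. f x + g x) \<in> C1_along \<omega>"
    "frechet_derivative (\<lambda>x. f x + g x) (at x) \<omega> =
       frechet_derivative f (at x) \<omega> + frechet_derivative g (at x) \<omega>"
proof -
  have d: "((\<lambda>x. f x + g x) has_derivative (\<lambda>v. frechet_derivative f (at x) v + frechet_derivative g (at x) v)) (at x)" for x
    by (rule has_derivative_add[OF C1_alongD(1)[OF assms(1)] C1_alongD(1)[OF assms(2)]])
  have c: "continuous_on UNIV (\<lambda>x. frechet_derivative f (at x) \<omega> + frechet_derivative g (at x) \<omega>)"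
    by (intro continuous_intros C1_alongD(2,3)[OF assms(1)] C1_alongD(2,3)[OF assms(2)])
  show "(\<lambda>x. f x + g x) \<in> C1_along \<omega>"
    "frechet_derivative (\<lambda>x. f x + g x) (at x) \<omega> = frechet_derivative f (at x) \<omega> + frechet_derivative g (at x) \<omega>"
    by (rule C1_alongI[OF d c])+
qed

lemma C1_along_mult:
  assumes "f \<in> C1_along \<omega>" "g \<in> C1_along \<omega>"
  shows "(\<lambda>x. f x * g x) \<in> C1_along \<omega>"
    "frechet_derivative (\<lambda>x. f x * g x) (at x) \<omega> =
       f x * frechet_derivative g (at x) \<omega> + frechet_derivative f (at x) \<omega> * g x"
proof -
  have d: "((\<lambda>x. f x * g x) has_derivative (\<lambda>v. f x * frechet_derivative g (at x) v + frechet_derivative f (at x) v * g x)) (at x)" for x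
    by (rule has_derivative_mult[OF C1_alongD(1)[OF assms(1)] C1_alongD(1)[OF assms(2)]])
  have c: "continuous_on UNIV (\<lambda>x. f x * frechet_derivative g (at x) \<omega> + frechet_derivative f (at x) \<omega> * g x)"
    by (intro continuous_intros C1_alongD(2,3)[OF assms(1)] C1_alongD(2,3)[OF assms(2)])
  show "(\<lambda>x. f x * g x) \<in> C1_along \<omega>"
    "frechet_derivative (\<lambda>x. f x * g x) (at x) \<omega> = f x * frechet_derivative g (at x) \<omega> + frechet_derivative f (at x) \<omega> * g x"
    by (rule C1_alongI[OF d c])+
qed

lemma C1_along_cmult:
  assumes "f \<in> C1_along \<omega>"
  shows "(\<lambda>x. c * f x) \<in> C1_along \<omega>"
    "frechet_derivative (\<lambda>x. c * f x) (at x) \<omega> = c * frechet_derivative f (at x) \<omega>"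
  using C1_along_mult[OF C1_along_const assms, of c] by simp_all

lemma C1_along_sum:
  assumes "\<And>i. i \<in> I \<Longrightarrow> f i \<in> C1_along \<omega>"
  shows "(\<lambda>x. \<Sum>i\<in>I. f i x) \<in> C1_along \<omega>"
  using assms
  by (induction I rule: infinite_finite_induct) (auto intro: C1_along_const C1_along_add)

lemma C1_along_prod:
  assumes "\<And>i. i \<in> I \<Longrightarrow> f i \<in> C1_along \<omega>"
  shows "(\<lambda>x. \<Prod>i\<in>I. f i x) \<in> C1_along \<omega>"
  using assms
  by (induction I rule: infinite_finite_induct) (auto intro: C1_along_const C1_along_mult)

lemma C1_along_power:
  "f \<in> C1_along \<omega> \<Longrightarrow> (\<lambda>x. f x ^ n) \<in> C1_along \<omega>"
  by (induction n) (auto intro: C1_along_const C1_along_mult)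

lemma C1_along_coord: "(\<lambda>x. of_real (x $ i)) \<in> C1_along \<omega>"
  by (rule C1_alongI(1)[where D = "\<lambda>_ v. of_real (v $ i)"])
     (auto intro!: derivative_eq_intros bounded_linear_imp_has_derivative
        bounded_linear_compose[OF bounded_linear_of_real] bounded_linear_vec_nth)

definition C1_linear :: "real ^ 'd::finite \<Rightarrow> ((real ^ 'd \<Rightarrow> complex) \<Rightarrow> complex) \<Rightarrow> bool" where
  "C1_linear \<omega> L \<longleftrightarrow>
     (\<forall>f\<in>C1_along \<omega>. \<forall>g\<in>C1_along \<omega>. L (\<lambda>x. f x + g x) = L f + L g) \<and>
     (\<forall>c. \<forall>f\<in>C1_along \<omega>. L (\<lambda>x. c * f x) = c * L f)"

lemma C1_linear_cmult: "C1_linear \<omega> L \<Longrightarrow> f \<in> C1_along \<omega> \<Longrightarrow> L (\<lambda>x. c * f x) = c * L f"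
  by (simp add: C1_linear_def)

lemma C1_linear_add:
  "C1_linear \<omega> L \<Longrightarrow> f \<in> C1_along \<omega> \<Longrightarrow> g \<in> C1_along \<omega> \<Longrightarrow> L (\<lambda>x. f x + g x) = L f + L g"
  by (simp add: C1_linear_def)

lemma C1_linear_sum:
  assumes L: "C1_linear \<omega> L" and I: "finite I" and f: "\<And>i. i \<in> I \<Longrightarrow> f i \<in> C1_along \<omega>"
  shows "L (\<lambda>x. \<Sum>i\<in>I. c i * f i x) = (\<Sum>i\<in>I. c i * L (f i))"
  using I f
proof (induction I rule: finite_induct)
  case empty
  show ?case using C1_linear_cmult[OF L C1_along_const, of 0] by simp
next
  case (insert i I)
  then have "L (\<lambda>x. c i * f i x + (\<Sum>i\<in>I. c i * f i x)) = L (\<lambda>x. c i * f i x) + L (\<lambda>x. \<Sum>i\<in>I. c i * f i x)"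
    by (intro C1_linear_add[OF L] C1_along_cmult C1_along_sum) auto
  then show ?case using insert C1_linear_cmult[OF L, of "f i" "c i"] by simp
qed

lemma C1_linear_combination:
  assumes I: "finite I" and L: "\<And>i. i \<in> I \<Longrightarrow> C1_linear \<omega> (L i)"
  shows "C1_linear \<omega> (\<lambda>f. \<Sum>i\<in>I. c i * L i f)"
  using L by (simp add: C1_linear_def sum.distrib sum_distrib_left distrib_left mult.left_commute)

lemma C1_linear_trunc_error:
  assumes X: "periodic_mesh X"
  shows "C1_linear \<omega> (\<lambda>f. trunc_error P \<omega> X S f j)"
proof -
  have "trunc_error P \<omega> X S (\<lambda>x. f x + g x) j = trunc_error P \<omega> X S f j + trunc_error P \<omega> X S g j"
    if "f \<in> C1_along \<omega>" "g \<in> C1_along \<omega>" for f g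
    using that
    by (simp add: trunc_error_def C1_along_add(2) proj_add[OF X] C1_alongD(2,3) distrib_left sum.distrib)
  moreover have "trunc_error P \<omega> X S (\<lambda>x. c * f x) j = c * trunc_error P \<omega> X S f j"
    if "f \<in> C1_along \<omega>" for c f
    using that
    by (simp add: trunc_error_def C1_along_cmult(2) proj_cmult sum_distrib_left distrib_left right_diff_distrib
        mult.left_commute)
  ultimately show ?thesis by (simp add: C1_linear_def)
qed

lemma cmod_trunc_error_le:
  assumes X: "periodic_mesh X" and f: "f \<in> C1_along \<omega>"
    and B: "\<And>k x. k \<in> stencil S j \<Longrightarrow> x \<in> insert (point X k) (cell X k) \<Longrightarrow>
              cmod (f x) \<le> B \<and> cmod (frechet_derivative f (at x) \<omega>) \<le> B"
  shows "cmod (trunc_error P \<omega> X S f j) \<le> (\<Sum>k\<in>stencil S j. \<bar>mcoef S j k\<bar> + \<bar>acoef S j k\<bar>) * B"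
proof -
  have "cmod (trunc_error P \<omega> X S f j) \<le>
      cmod (\<Sum>k\<in>stencil S j. of_real (mcoef S j k) * proj P X (\<lambda>x. frechet_derivative f (at x) \<omega>) k) +
      cmod (\<Sum>k\<in>stencil S j. of_real (acoef S j k) * proj P X f k)"
    unfolding trunc_error_def by (rule order_trans[OF norm_triangle_ineq]) simp
  also have "\<dots> \<le> (\<Sum>k\<in>stencil S j. \<bar>mcoef S j k\<bar> * B) + (\<Sum>k\<in>stencil S j. \<bar>acoef S j k\<bar> * B)"
    using B
    by (intro add_mono sum_norm_le)
       (auto simp: norm_mult intro!: mult_left_mono cmod_proj_le[OF X] C1_alongD[OF f])
  finally show ?thesis by (simp add: sum_distrib_right distrib_right sum.distrib)
qed

section \<open>Polarisation\<close>

definition cmonom :: "('d::finite \<Rightarrow> nat) \<Rightarrow> real ^ 'd \<Rightarrow> complex" where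
  "cmonom e x = (\<Prod>i\<in>UNIV. of_real (x $ i) ^ e i)"

definition linform :: "int ^ 'd::finite \<Rightarrow> real ^ 'd \<Rightarrow> complex" where
  "linform \<alpha> x = (\<Sum>i\<in>UNIV. of_int (\<alpha> $ i) * of_real (x $ i))"

lemma C1_cmonom: "cmonom e \<in> C1_along \<omega>"
  using C1_along_prod[of UNIV "\<lambda>i x. of_real (x $ i) ^ e i" \<omega>]
  by (simp add: cmonom_def[abs_def] C1_along_power C1_along_coord)

lemma C1_linform: "linform \<alpha> \<in> C1_along \<omega>"
  using C1_along_sum[of UNIV "\<lambda>i x. of_int (\<alpha> $ i) * of_real (x $ i)" \<omega>]
  by (simp add: linform_def[abs_def] C1_along_cmult C1_along_coord)

lemma C1_linform_power_cmonom: "(\<lambda>x. linform \<alpha> x ^ n * cmonom e x) \<in> C1_along \<omega>"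
  by (intro C1_along_mult C1_along_power C1_linform C1_cmonom)

lemma cmonom_Suc: "cmonom (e(i := Suc (e i))) x = of_real (x $ i) * cmonom e x"
proof -
  have "cmonom (e(i := Suc (e i))) x =
      of_real (x $ i) ^ Suc (e i) * (\<Prod>k\<in>UNIV - {i}. of_real (x $ k) ^ (e(i := Suc (e i))) k)"
    unfolding cmonom_def by (subst prod.remove[of _ i]) auto
  also have "(\<Prod>k\<in>UNIV - {i}. complex_of_real (x $ k) ^ (e(i := Suc (e i))) k) =
      (\<Prod>k\<in>UNIV - {i}. of_real (x $ k) ^ e k)"
    by (intro prod.cong) auto
  also have "of_real (x $ i) ^ Suc (e i) * (\<Prod>k\<in>UNIV - {i}. complex_of_real (x $ k) ^ e k) =
      of_real (x $ i) * (\<Prod>k\<in>UNIV. of_real (x $ k) ^ e k)"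
    by (subst prod.remove[of _ i]) (auto simp: mult.assoc)
  finally show ?thesis by (simp add: cmonom_def)
qed

lemma sum_fun_upd_Suc: "(\<Sum>k\<in>UNIV. (e(i := Suc (e i))) k) = Suc (\<Sum>k\<in>(UNIV::'d::finite set). e k)"
proof -
  have "(\<Sum>k\<in>UNIV. (e(i := Suc (e i))) k) = Suc (e i) + (\<Sum>k\<in>UNIV - {i}. (e(i := Suc (e i))) k)"
    by (subst sum.remove[of _ i]) auto
  also have "(\<Sum>k\<in>UNIV - {i}. (e(i := Suc (e i))) k) = (\<Sum>k\<in>UNIV - {i}. e k)"
    by (intro sum.cong) auto
  also have "Suc (e i) + \<dots> = Suc (\<Sum>k\<in>UNIV. e k)" by (simp add: sum.remove[of UNIV i e])
  finally show ?thesis .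
qed

text \<open>
  Multiplying out the linear forms one at a time replaces the multinomial theorem: each factor is
  a combination of coordinates, which raise the exponent of the monomial.
\<close>

lemma power_linform_vanishes:
  assumes L: "C1_linear \<omega> L"
    and z: "\<And>e. (\<Sum>i\<in>UNIV. e i) \<le> p \<Longrightarrow> L (cmonom e) = 0"
  shows "n + (\<Sum>i\<in>UNIV. e i) \<le> p \<Longrightarrow> L (\<lambda>x. linform \<alpha> x ^ n * cmonom e x) = 0"
proof (induction n arbitrary: e)
  case 0
  then show ?case using z[of e] by simp
next
  case (Suc n)
  have expand: "linform \<alpha> x * (a * c) = (\<Sum>i\<in>UNIV. of_int (\<alpha> $ i) * (a * (of_real (x $ i) * c)))" for x a c
    by (simp add: linform_def sum_distrib_left mult_ac)
  have "(\<lambda>x. linform \<alpha> x ^ Suc n * cmonom e x) =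
     (\<lambda>x. \<Sum>i\<in>UNIV. of_int (\<alpha> $ i) * (linform \<alpha> x ^ n * cmonom (e(i := Suc (e i))) x))"
    by (rule ext) (simp only: cmonom_Suc expand[symmetric] power_Suc mult.assoc)
  then have "L (\<lambda>x. linform \<alpha> x ^ Suc n * cmonom e x) =
     (\<Sum>i\<in>UNIV. of_int (\<alpha> $ i) * L (\<lambda>x. linform \<alpha> x ^ n * cmonom (e(i := Suc (e i))) x))"
    by (simp add: C1_linear_sum[OF L] C1_linform_power_cmonom)
  also have "L (\<lambda>x. linform \<alpha> x ^ n * cmonom (e(i := Suc (e i))) x) = 0" for i
  proof (rule Suc.IH)
    show "n + (\<Sum>k\<in>UNIV. (e(i := Suc (e i))) k) \<le> p"
      unfolding sum_fun_upd_Suc using Suc.prems by simp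
  qed
  then have "(\<Sum>i\<in>UNIV. of_int (\<alpha> $ i) * L (\<lambda>x. linform \<alpha> x ^ n * cmonom (e(i := Suc (e i))) x)) = 0"
    by simp
  finally show ?case .
qed

lemma polynomial_vanishing_on_nat:
  fixes c :: "nat \<Rightarrow> complex"
  assumes "\<And>s::nat. (\<Sum>r\<le>m. c r * of_nat s ^ r) = 0" "r \<le> m"
  shows "c r = 0"
proof (rule ccontr)
  assume "c r \<noteq> 0"
  then have "finite {z. (\<Sum>r\<le>m. c r * z ^ r) = 0}"
    using polyfun_rootbound[of m c] assms(2) by blast
  moreover have "range (of_nat :: nat \<Rightarrow> complex) \<subseteq> {z. (\<Sum>r\<le>m. c r * z ^ r) = 0}"
    using assms(1) by auto
  ultimately have "finite (range (of_nat :: nat \<Rightarrow> complex))" using finite_subset by blast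
  then show False using finite_imageD[OF _ inj_of_nat] infinite_UNIV_nat by blast
qed

text \<open>
  Powers of integral linear forms span the homogeneous polynomials. The functional vanishes on
  \<open>(\<alpha> \<cdot> x + s x\<^sub>i) ^ m * q\<close> for all natural \<open>s\<close>, hence so does every coefficient of this
  polynomial in \<open>s\<close>; the coefficient of \<open>s\<close> trades one factor \<open>\<alpha> \<cdot> x\<close> for the coordinate
  \<open>x\<^sub>i\<close>. Repeating this turns a power of a linear form into any monomial of the same degree.
\<close>

lemma linform_power_separates:
  assumes L: "C1_linear \<omega> L" and z: "\<And>\<alpha>. L (\<lambda>x. linform \<alpha> x ^ n) = 0"
  shows "(\<Sum>i\<in>UNIV. e i) = k \<Longrightarrow> k \<le> n \<Longrightarrow> L (\<lambda>x. linform \<alpha> x ^ (n - k) * cmonom e x) = 0"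
proof (induction k arbitrary: e \<alpha>)
  case 0
  then have "cmonom e = (\<lambda>x. 1)" by (simp add: cmonom_def[abs_def])
  then show ?case using z by simp
next
  case (Suc k)
  obtain i where i: "e i > 0" using Suc(2) by (metis gr0I sum.neutral nat.distinct(1))
  define e' where "e' = e(i := e i - 1)"
  have e: "e = e'(i := Suc (e' i))" using i by (auto simp: e'_def)
  then have se: "(\<Sum>i\<in>UNIV. e' i) = k" using Suc(2) sum_fun_upd_Suc[of e' i] by simp
  define m where "m = n - k"
  define f where "f r x = of_real (x $ i) ^ r * linform \<alpha> x ^ (m - r) * cmonom e' x" for r x
  have fC: "f r \<in> C1_along \<omega>" for r
    unfolding f_def[abs_def] by (intro C1_along_mult C1_along_power C1_linform C1_cmonom C1_along_coord)
  have "(\<Sum>r\<le>m. (of_nat (m choose r) * L (f r)) * of_nat s ^ r) = 0" for s :: nat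
  proof -
    define \<beta> where "\<beta> = \<alpha> + (\<chi> l. if l = i then int s else 0)"
    have "linform \<beta> x = of_nat s * of_real (x $ i) + linform \<alpha> x" for x
    proof -
      have "linform \<beta> x = (\<Sum>l\<in>UNIV. of_int (\<alpha> $ l) * of_real (x $ l)) +
          (\<Sum>l\<in>UNIV. if l = i then of_nat s * of_real (x $ i) else 0)"
        unfolding linform_def \<beta>_def
        by (subst sum.distrib[symmetric]) (auto intro!: sum.cong simp: algebra_simps)
      then show ?thesis by (simp add: linform_def)
    qed
    then have "(\<lambda>x. linform \<beta> x ^ m * cmonom e' x) =
       (\<lambda>x. \<Sum>r\<le>m. (of_nat (m choose r) * of_nat s ^ r) * f r x)"
      by (rule_tac ext) (simp add: binomial_ring f_def sum_distrib_left power_mult_distrib mult_ac)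
    then have "L (\<lambda>x. linform \<beta> x ^ m * cmonom e' x) =
       (\<Sum>r\<le>m. (of_nat (m choose r) * of_nat s ^ r) * L (f r))"
      by (simp add: C1_linear_sum[OF L] fC)
    moreover have "L (\<lambda>x. linform \<beta> x ^ m * cmonom e' x) = 0"
      using Suc(1)[OF se, of \<beta>] Suc(3) by (simp add: m_def)
    ultimately show ?thesis by (simp add: mult_ac)
  qed
  moreover have "1 \<le> m" using Suc(3) by (simp add: m_def)
  ultimately have "of_nat (m choose 1) * L (f 1) = 0"
    using polynomial_vanishing_on_nat[where m = m and c = "\<lambda>r. of_nat (m choose r) * L (f r)" and r = 1] by blast
  then have "L (f 1) = 0" using \<open>1 \<le> m\<close> by simp
  moreover have "f 1 = (\<lambda>x. linform \<alpha> x ^ (n - Suc k) * cmonom e x)"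
    by (subst e, subst cmonom_Suc) (auto simp: f_def m_def)
  ultimately show ?case by simp
qed

lemma finite_exponents: "finite {e :: 'd::finite \<Rightarrow> nat. (\<Sum>i\<in>UNIV. e i) \<le> q}"
proof (rule finite_subset)
  show "{e :: 'd \<Rightarrow> nat. (\<Sum>i\<in>UNIV. e i) \<le> q} \<subseteq> PiE UNIV (\<lambda>_. {..q})"
  proof
    fix e :: "'d \<Rightarrow> nat" assume "e \<in> {e. (\<Sum>i\<in>UNIV. e i) \<le> q}"
    then have "e i \<le> q" for i using member_le_sum[of i UNIV e] by simp
    then show "e \<in> PiE UNIV (\<lambda>_. {..q})" by auto
  qed
qed (intro finite_PiE finite finite_atMost)

lemma of_real_monomial: "of_real (\<Prod>i\<in>UNIV. (x $ i) ^ e i) = cmonom e x"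
  by (simp add: cmonom_def)

lemma cmonom_in_polys:
  assumes "(\<Sum>i\<in>UNIV. e i) \<le> q"
  shows "cmonom e \<in> polys q"
proof -
  have "cmonom e x = (\<Sum>e' | (\<Sum>i\<in>UNIV. e' i) \<le> q. (if e' = e then 1 else 0) * cmonom e' x)" for x
    using assms by (simp add: finite_exponents if_distrib[of "\<lambda>c. c * _"] cong: if_cong)
  then show ?thesis
    unfolding polys_def of_real_monomial mem_Collect_eq
    by (intro exI[of _ "\<lambda>e'. if e' = e then 1 else 0"] allI)
qed

text \<open>
  The direction of the plane wave: a functional that kills low degrees but not all polynomials of
  degree \<open>Suc p\<close> is nonzero on some monomial of degree exactly \<open>Suc p\<close>, hence, by polarisation, on a
  power of an integral linear form.
\<close>

lemma exists_wave_direction: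
  assumes L: "C1_linear \<omega> L"
    and z: "\<And>e. (\<Sum>i\<in>UNIV. e i) \<le> p \<Longrightarrow> L (cmonom e) = 0"
    and f: "f \<in> polys (Suc p)" "L f \<noteq> 0"
  shows "\<exists>\<alpha>. L (\<lambda>x. linform \<alpha> x ^ Suc p) \<noteq> 0"
proof (rule ccontr)
  assume "\<nexists>\<alpha>. L (\<lambda>x. linform \<alpha> x ^ Suc p) \<noteq> 0"
  then have n: "L (\<lambda>x. linform \<alpha> x ^ Suc p) = 0" for \<alpha> by simp
  have m: "L (cmonom e) = 0" if e: "(\<Sum>i\<in>UNIV. e i) \<le> Suc p" for e
  proof (cases "(\<Sum>i\<in>UNIV. e i) \<le> p")
    case True then show ?thesis by (rule z)
  next
    case False
    then show ?thesis using linform_power_separates[OF L n, of e "Suc p"] e by simp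
  qed
  obtain c where "\<And>x. f x = (\<Sum>e | (\<Sum>i\<in>UNIV. e i) \<le> Suc p. c e * cmonom e x)"
    using f(1) unfolding polys_def of_real_monomial by blast
  then have "f = (\<lambda>x. \<Sum>e | (\<Sum>i\<in>UNIV. e i) \<le> Suc p. c e * cmonom e x)" by blast
  then have "L f = (\<Sum>e | (\<Sum>i\<in>UNIV. e i) \<le> Suc p. c e * L (cmonom e))"
    by (simp add: C1_linear_sum[OF L finite_exponents C1_cmonom])
  also have "\<dots> = 0" using m by (intro sum.neutral) auto
  finally show False using f(2) by simp
qed

section \<open>Truncation error of a plane wave\<close>

definition exp_remainder :: "nat \<Rightarrow> complex \<Rightarrow> complex" where
  "exp_remainder n z = exp z - (\<Sum>k\<le>n. z ^ k / fact k)"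

lemma has_field_derivative_exp_sum:
  "((\<lambda>z::complex. \<Sum>k\<le>Suc n. z ^ k / fact k) has_field_derivative (\<Sum>k\<le>n. z ^ k / fact k)) (at z)"
proof (induction n)
  case 0
  have "((\<lambda>z::complex. 1 + z) has_field_derivative 1) (at z)"
    by (auto intro!: derivative_eq_intros)
  then show ?case by simp
next
  case (Suc n)
  have "((\<lambda>z::complex. z ^ Suc (Suc n)) has_field_derivative of_nat (Suc (Suc n)) * z ^ Suc n) (at z)"
    using DERIV_power[OF DERIV_ident, where n = "Suc (Suc n)"] by (simp del: of_nat_Suc power_Suc)
  then have "((\<lambda>z::complex. z ^ Suc (Suc n) / fact (Suc (Suc n))) has_field_derivative
      (of_nat (Suc (Suc n)) * z ^ Suc n) / fact (Suc (Suc n))) (at z)"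
    by (rule DERIV_cdivide)
  also have "(of_nat (Suc (Suc n)) * z ^ Suc n) / fact (Suc (Suc n)) = z ^ Suc n / fact (Suc n)"
    by (simp only: fact_Suc of_nat_mult) (simp del: of_nat_Suc power_Suc)
  finally have 1: "((\<lambda>z::complex. z ^ Suc (Suc n) / fact (Suc (Suc n))) has_field_derivative
      z ^ Suc n / fact (Suc n)) (at z)" .
  show ?case
    using DERIV_add[OF Suc 1] by (simp only: sum.atMost_Suc[of _ "Suc n"] sum.atMost_Suc[of _ n])
qed

lemma has_field_derivative_exp_remainder:
  "(exp_remainder (Suc n) has_field_derivative exp_remainder n z) (at z)"
  unfolding exp_remainder_def[abs_def]
  by (rule DERIV_diff[OF DERIV_exp has_field_derivative_exp_sum])

lemma continuous_exp_remainder: "continuous_on UNIV (exp_remainder n)"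
  unfolding exp_remainder_def[abs_def] by (intro continuous_intros) auto

lemma cmod_exp_remainder_le: "Re z = 0 \<Longrightarrow> cmod (exp_remainder n z) \<le> cmod z ^ Suc n"
proof -
  assume "Re z = 0"
  then have "cmod (exp_remainder n z) \<le> cmod z ^ Suc n / fact n"
    using Taylor_exp[of z n] by (simp add: exp_remainder_def)
  also have "\<dots> \<le> cmod z ^ Suc n / 1" by (intro divide_left_mono) auto
  finally show ?thesis by simp
qed

lemma linform_of_real: "linform \<alpha> x = of_real (\<Sum>i\<in>UNIV. of_int (\<alpha> $ i) * x $ i)"
  by (simp add: linform_def)

lemma linform_add: "linform \<alpha> (x + y) = linform \<alpha> x + linform \<alpha> y"
  by (simp add: linform_def distrib_left sum.distrib)

lemma linform_scaleR: "linform \<alpha> (s *\<^sub>R x) = of_real s * linform \<alpha> x"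
  by (simp add: linform_def sum_distrib_left mult_ac)

lemma bounded_linear_linform: "bounded_linear (linform \<alpha>)"
proof (rule linear_conv_bounded_linear[THEN iffD1], rule linearI)
  show "linform \<alpha> (r *\<^sub>R x) = r *\<^sub>R linform \<alpha> x" for r x
    unfolding linform_scaleR by (simp add: scaleR_conv_of_real)
qed (rule linform_add)

lemma Re_wave_phase: "Re (2 * of_real pi * \<i> * of_real s * linform \<alpha> x) = 0"
  by (simp add: linform_of_real)

lemma plane_wave_eq: "plane_wave \<alpha> x = exp (2 * of_real pi * \<i> * linform \<alpha> x)"
  by (simp add: plane_wave_def linform_of_real)

lemma plane_wave_add: "plane_wave \<alpha> (x + y) = plane_wave \<alpha> x * plane_wave \<alpha> y"
  by (simp add: plane_wave_eq linform_add distrib_left exp_add)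

lemma cmod_plane_wave [simp]: "cmod (plane_wave \<alpha> x) = 1"
  by (simp add: plane_wave_eq linform_of_real)

lemma plane_wave_nonzero [simp]: "plane_wave \<alpha> x \<noteq> 0"
  by (simp add: plane_wave_eq)

lemma plane_wave_int_vector:
  assumes "z \<in> int_vectors"
  shows "plane_wave \<alpha> z = 1"
proof -
  have "(\<Sum>i\<in>UNIV. of_int (\<alpha> $ i) * z $ i) \<in> \<int>"
    using assms by (intro Ints_sum Ints_mult) (auto simp: int_vectors_def)
  then obtain n where "(\<Sum>i\<in>UNIV. of_int (\<alpha> $ i) * z $ i) = real_of_int n" by (auto elim: Ints_cases)
  then have "plane_wave \<alpha> z = exp (2 * of_int n * of_real pi * \<i>)"
    by (simp add: plane_wave_def mult_ac)
  then show ?thesis using exp_integer_2pi[of "of_int n"] by simp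
qed

lemma C1_compose_linform:
  assumes "\<And>z. (G has_field_derivative G' z) (at z)" "continuous_on UNIV G'"
  shows "(\<lambda>x. G (c * linform \<alpha> x)) \<in> C1_along \<omega>"
    "frechet_derivative (\<lambda>x. G (c * linform \<alpha> x)) (at x) \<omega> = G' (c * linform \<alpha> x) * (c * linform \<alpha> \<omega>)"
proof -
  have l: "((\<lambda>x. c * linform \<alpha> x) has_derivative (\<lambda>v. c * linform \<alpha> v)) (at x)" for x
    by (intro bounded_linear_imp_has_derivative bounded_linear_const_mult bounded_linear_linform)
  have G: "(G has_derivative (*) (G' z)) (at z)" for z
    using assms(1) by (simp add: has_field_derivative_def)
  have d: "((\<lambda>x. G (c * linform \<alpha> x)) has_derivative (\<lambda>v. G' (c * linform \<alpha> x) * (c * linform \<alpha> v))) (at x)" for x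
    using diff_chain_at[OF l[of x] G] by (simp add: o_def)
  have "continuous_on UNIV (\<lambda>x. c * linform \<alpha> x)"
    by (intro continuous_intros linear_continuous_on bounded_linear_linform)
  then have "continuous_on UNIV (\<lambda>x. G' (c * linform \<alpha> x))"
    using continuous_on_compose2[OF assms(2)] by blast
  then have c: "continuous_on UNIV (\<lambda>x. G' (c * linform \<alpha> x) * (c * linform \<alpha> \<omega>))"
    by (intro continuous_intros)
  show "(\<lambda>x. G (c * linform \<alpha> x)) \<in> C1_along \<omega>"
    "frechet_derivative (\<lambda>x. G (c * linform \<alpha> x)) (at x) \<omega> = G' (c * linform \<alpha> x) * (c * linform \<alpha> \<omega>)"
    by (rule C1_alongI[OF d c])+
qed

lemma trunc_error_linform_power:
  assumes X: "periodic_mesh X" and p: "p_exact p P \<omega> X S" and n: "n \<le> p"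
  shows "trunc_error P \<omega> X S (\<lambda>x. linform \<alpha> x ^ n) j = 0"
proof -
  have "trunc_error P \<omega> X S (cmonom e) j = 0" if "(\<Sum>i\<in>UNIV. e i) \<le> p" for e
    using p cmonom_in_polys[OF that] by (simp add: p_exact_def)
  from power_linform_vanishes[where n = n and e = "\<lambda>_. 0" and \<alpha> = \<alpha>,
      OF C1_linear_trunc_error[OF X] this] n
  show ?thesis by (simp add: cmonom_def)
qed

lemma plane_wave_scaleR: "plane_wave \<alpha> (s *\<^sub>R x) = exp (2 * of_real pi * \<i> * of_real s * linform \<alpha> x)"
  by (simp add: plane_wave_eq linform_scaleR mult.assoc)

text \<open>
  In the Taylor expansion of the wave in \<open>s\<close>, the terms of degree at most \<open>p\<close> have no truncation
  error by exactness. The Taylor remainder and its derivative along \<open>\<omega>\<close> are both of order \<open>s ^ (p + 2)\<close>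
  on the bounded set that the stencil sees: differentiation loses one order of the remainder, but
  produces another factor \<open>s\<close>.
\<close>

lemma trunc_error_plane_wave:
  assumes X: "periodic_mesh X" and p: "p_exact p P \<omega> X S" and fin: "finite (stencil S j)"
  shows "\<exists>C. \<forall>s\<ge>0. cmod (trunc_error P \<omega> X S (\<lambda>x. plane_wave \<alpha> (s *\<^sub>R x)) j
            - (2 * of_real pi * \<i> * of_real s) ^ Suc p / fact (Suc p) *
                trunc_error P \<omega> X S (\<lambda>x. linform \<alpha> x ^ Suc p) j) \<le> C * s ^ (p + 2)"
proof -
  \<comment> \<open>Including \<open>\<omega>\<close> lets the same bound control the factor produced by differentiation along \<open>\<omega>\<close>.\<close>
  define B where "B = insert \<omega> (\<Union>k\<in>stencil S j. insert (point X k) (cell X k))"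
  have "bounded B" unfolding B_def using fin bounded_cell[OF X] by auto
  then have "bounded (linform \<alpha> ` B)" by (rule bounded_linear_image[OF _ bounded_linear_linform])
  then obtain M where M: "\<And>x. x \<in> B \<Longrightarrow> cmod (linform \<alpha> x) \<le> M"
    by (auto simp: bounded_iff)
  define K where "K = (\<Sum>k\<in>stencil S j. \<bar>mcoef S j k\<bar> + \<bar>acoef S j k\<bar>)"
  let ?T = "\<lambda>f. trunc_error P \<omega> X S f j"
  have L: "C1_linear \<omega> ?T" by (rule C1_linear_trunc_error[OF X])
  have "cmod (?T (\<lambda>x. plane_wave \<alpha> (s *\<^sub>R x)) -
      (2 * of_real pi * \<i> * of_real s) ^ Suc p / fact (Suc p) * ?T (\<lambda>x. linform \<alpha> x ^ Suc p))
      \<le> (K * (2 * pi * M) ^ (p + 2)) * s ^ (p + 2)" if s: "s \<ge> 0" for s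
  proof -
    define c where "c = 2 * of_real pi * \<i> * of_real s"
    have Re: "Re (c * linform \<alpha> x) = 0" for x unfolding c_def by (rule Re_wave_phase)
    have nc: "cmod c = 2 * pi * s" using s by (simp add: c_def norm_mult)
    have le: "cmod (c * linform \<alpha> x) \<le> 2 * pi * M * s" if "x \<in> B" for x
      using mult_left_mono[OF M[OF that], of "2 * pi * s"] s nc by (simp add: norm_mult mult_ac)
    define r where "r = (\<lambda>x. exp_remainder (Suc p) (c * linform \<alpha> x))"
    have r: "r \<in> C1_along \<omega>"
       "frechet_derivative r (at x) \<omega> = exp_remainder p (c * linform \<alpha> x) * (c * linform \<alpha> \<omega>)" for x
      unfolding r_def
      by (rule C1_compose_linform[OF has_field_derivative_exp_remainder continuous_exp_remainder])+
    have "cmod (r x) \<le> (2 * pi * M * s) ^ (p + 2) \<and>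
        cmod (frechet_derivative r (at x) \<omega>) \<le> (2 * pi * M * s) ^ (p + 2)"
      if "k \<in> stencil S j" "x \<in> insert (point X k) (cell X k)" for k x
    proof -
      have x: "x \<in> B" using that by (auto simp: B_def)
      have w: "\<omega> \<in> B" by (simp add: B_def)
      have "cmod (r x) \<le> cmod (c * linform \<alpha> x) ^ Suc (Suc p)"
        unfolding r_def by (rule cmod_exp_remainder_le[OF Re])
      also have "\<dots> \<le> (2 * pi * M * s) ^ Suc (Suc p)" by (rule power_mono[OF le[OF x] norm_ge_zero])
      finally have 1: "cmod (r x) \<le> (2 * pi * M * s) ^ (p + 2)" by simp
      have "cmod (exp_remainder p (c * linform \<alpha> x)) \<le> cmod (c * linform \<alpha> x) ^ Suc p"
        by (rule cmod_exp_remainder_le[OF Re])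
      also have "\<dots> \<le> (2 * pi * M * s) ^ Suc p" by (rule power_mono[OF le[OF x] norm_ge_zero])
      finally have e: "cmod (exp_remainder p (c * linform \<alpha> x)) \<le> (2 * pi * M * s) ^ Suc p" .
      have "cmod (exp_remainder p (c * linform \<alpha> x) * (c * linform \<alpha> \<omega>))
          \<le> (2 * pi * M * s) ^ Suc p * (2 * pi * M * s)"
        unfolding norm_mult[of "exp_remainder p (c * linform \<alpha> x)"]
        by (rule mult_mono[OF e le[OF w] order_trans[OF norm_ge_zero e] norm_ge_zero])
      then show ?thesis using 1 by (simp add: r(2) mult_ac)
    qed
    then have "cmod (?T r) \<le> K * (2 * pi * M * s) ^ (p + 2)"
      unfolding K_def by (rule cmod_trunc_error_le[OF X r(1)])
    moreover have "?T r = ?T (\<lambda>x. plane_wave \<alpha> (s *\<^sub>R x)) -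
        c ^ Suc p / fact (Suc p) * ?T (\<lambda>x. linform \<alpha> x ^ Suc p)"
    proof -
      have "(\<lambda>x. plane_wave \<alpha> (s *\<^sub>R x)) = (\<lambda>x. r x + (\<Sum>k\<le>Suc p. c ^ k / fact k * linform \<alpha> x ^ k))"
        by (rule ext)
          (simp add: plane_wave_scaleR r_def exp_remainder_def power_mult_distrib c_def del: sum.atMost_Suc)
      moreover have "(\<lambda>x. \<Sum>k\<le>Suc p. c ^ k / fact k * linform \<alpha> x ^ k) \<in> C1_along \<omega>"
        by (intro C1_along_sum C1_along_cmult C1_along_power C1_linform)
      ultimately have "?T (\<lambda>x. plane_wave \<alpha> (s *\<^sub>R x)) =
          ?T r + ?T (\<lambda>x. \<Sum>k\<le>Suc p. c ^ k / fact k * linform \<alpha> x ^ k)"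
        by (simp only: C1_linear_add[OF L r(1)])
      also have "?T (\<lambda>x. \<Sum>k\<le>Suc p. c ^ k / fact k * linform \<alpha> x ^ k) =
          (\<Sum>k\<le>Suc p. c ^ k / fact k * ?T (\<lambda>x. linform \<alpha> x ^ k))"
        by (rule C1_linear_sum[OF L finite_atMost]) (intro C1_along_power C1_linform)
      also have "\<dots> = c ^ Suc p / fact (Suc p) * ?T (\<lambda>x. linform \<alpha> x ^ Suc p)"
        using trunc_error_linform_power[OF X p] by simp
      finally show ?thesis by simp
    qed
    ultimately show ?thesis by (simp add: c_def power_mult_distrib mult_ac)
  qed
  then show ?thesis by blast
qed

lemma sum_trunc_error_plane_wave:
  assumes X: "periodic_mesh X" and p: "p_exact p P \<omega> X S" and fin: "\<And>j. finite (stencil S j)"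
    and R: "finite R"
  shows "\<exists>C. \<forall>s\<ge>0. cmod ((\<Sum>j\<in>R. of_real (vol X j) * trunc_error P \<omega> X S (\<lambda>x. plane_wave \<alpha> (s *\<^sub>R x)) j)
            - (2 * of_real pi * \<i> * of_real s) ^ Suc p / fact (Suc p) *
                (\<Sum>j\<in>R. of_real (vol X j) * trunc_error P \<omega> X S (\<lambda>x. linform \<alpha> x ^ Suc p) j))
          \<le> C * s ^ (p + 2)"
proof -
  let ?T = "\<lambda>f j. trunc_error P \<omega> X S f j"
  let ?d = "\<lambda>s j. ?T (\<lambda>x. plane_wave \<alpha> (s *\<^sub>R x)) j
            - (2 * of_real pi * \<i> * of_real s) ^ Suc p / fact (Suc p) * ?T (\<lambda>x. linform \<alpha> x ^ Suc p) j"
  obtain C where C: "\<And>j s. s \<ge> 0 \<Longrightarrow> cmod (?d s j) \<le> C j * s ^ (p + 2)"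
    using trunc_error_plane_wave[OF X p fin] by metis
  have "cmod ((\<Sum>j\<in>R. of_real (vol X j) * ?T (\<lambda>x. plane_wave \<alpha> (s *\<^sub>R x)) j)
            - (2 * of_real pi * \<i> * of_real s) ^ Suc p / fact (Suc p) *
                (\<Sum>j\<in>R. of_real (vol X j) * ?T (\<lambda>x. linform \<alpha> x ^ Suc p) j))
          \<le> (\<Sum>j\<in>R. vol X j * C j) * s ^ (p + 2)" if s: "s \<ge> 0" for s
  proof -
    have "(\<Sum>j\<in>R. of_real (vol X j) * ?T (\<lambda>x. plane_wave \<alpha> (s *\<^sub>R x)) j)
            - (2 * of_real pi * \<i> * of_real s) ^ Suc p / fact (Suc p) *
                (\<Sum>j\<in>R. of_real (vol X j) * ?T (\<lambda>x. linform \<alpha> x ^ Suc p) j) = (\<Sum>j\<in>R. of_real (vol X j) * ?d s j)"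
      unfolding sum_distrib_left sum_subtractf[symmetric]
      by (intro sum.cong refl) (simp only: right_diff_distrib mult_ac)
    also have "cmod \<dots> \<le> (\<Sum>j\<in>R. vol X j * (C j * s ^ (p + 2)))"
      using C[OF s] less_imp_le[OF vol_pos[OF X]]
      by (intro sum_norm_le) (auto simp only: norm_mult norm_of_real abs_of_nonneg intro!: mult_left_mono)
    finally show ?thesis by (simp only: sum_distrib_right mult.assoc)
  qed
  then show ?thesis by blast
qed

section \<open>Translation covariance of solutions\<close>

lemma scale_scheme_simps [simp]:
  "stencil (scale_scheme h S) = stencil S" "mcoef (scale_scheme h S) = mcoef S"
  "acoef (scale_scheme h S) = (\<lambda>j k. acoef S j k / h)"
  by (simp_all add: scale_scheme_def)

lemma admissible_scale:
  assumes S: "admissible_scheme X S" and h: "h > 0"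
  shows "admissible_scheme (scale_mesh h X) (scale_scheme h S)"
proof -
  have "translates X ((1 / h) *\<^sub>R v) \<sigma>" if "translates (scale_mesh h X) v \<sigma>" for v \<sigma>
    using translates_scale_mesh[of h X "(1 / h) *\<^sub>R v" \<sigma>] that h by simp
  then show ?thesis using S unfolding admissible_scheme_def scale_scheme_simps by metis
qed

lemma admissible_sum_translates:
  assumes S: "admissible_scheme X S" and t: "translates X v \<tau>"
  shows "(\<Sum>k\<in>stencil S (\<tau> j). of_real (mcoef S (\<tau> j) k) * g k) = (\<Sum>k\<in>stencil S j. of_real (mcoef S j k) * g (\<tau> k))"
    and "(\<Sum>k\<in>stencil S (\<tau> j). of_real (acoef S (\<tau> j) k) * g k) = (\<Sum>k\<in>stencil S j. of_real (acoef S j k) * g (\<tau> k))"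
proof -
  have st: "stencil S (\<tau> j) = \<tau> ` stencil S j"
    and c: "\<And>k. k \<in> stencil S j \<Longrightarrow> mcoef S (\<tau> j) (\<tau> k) = mcoef S j k \<and> acoef S (\<tau> j) (\<tau> k) = acoef S j k"
    using S t unfolding admissible_scheme_def by blast+
  have inj: "inj_on \<tau> (stencil S j)"
    using translates_bij[OF t] by (meson bij_is_inj inj_on_subset subset_UNIV)
  show "(\<Sum>k\<in>stencil S (\<tau> j). of_real (mcoef S (\<tau> j) k) * g k) = (\<Sum>k\<in>stencil S j. of_real (mcoef S j k) * g (\<tau> k))"
    "(\<Sum>k\<in>stencil S (\<tau> j). of_real (acoef S (\<tau> j) k) * g k) = (\<Sum>k\<in>stencil S j. of_real (acoef S j k) * g (\<tau> k))"
    unfolding st sum.reindex[OF inj] using c by (auto intro!: sum.cong)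
qed

lemma Vper_translates:
  assumes t: "translates X v \<tau>" and u: "u \<in> Vper X"
  shows "(\<lambda>j. c * u (\<tau> j)) \<in> Vper X"
  unfolding Vper_def
proof (intro CollectI ballI allI impI)
  fix z \<sigma> j assume z: "z \<in> int_vectors" "translates X z \<sigma>"
  \<comment> \<open>The conjugate of a mesh translation is again a translation by \<open>z\<close>.\<close>
  have "translates X (- v + (z + v)) ((\<tau> \<circ> \<sigma>) \<circ> inv \<tau>)"
    by (intro translates_comp translates_inv z t)
  then have "translates X z ((\<tau> \<circ> \<sigma>) \<circ> inv \<tau>)" by simp
  then have "u (((\<tau> \<circ> \<sigma>) \<circ> inv \<tau>) (\<tau> j)) = u (\<tau> j)" using u z(1) unfolding Vper_def by blast
  then show "c * u (\<tau> (\<sigma> j)) = c * u (\<tau> j)"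
    using translates_bij[OF t] by (simp add: bij_is_inj)
qed

text \<open>
  For \<open>c = 1\<close> this is translation covariance of the scheme; the factor lets a quasi-periodic
  datum be mapped to itself.
\<close>

lemma is_solution_translates:
  assumes S: "admissible_scheme X S" and t: "translates X v \<tau>" and u: "is_solution X S f u"
  shows "is_solution X S (\<lambda>j. c * f (\<tau> j)) (\<lambda>t j. c * u t (\<tau> j))"
proof -
  obtain u' where u': "\<And>t k. t \<ge> 0 \<Longrightarrow> ((\<lambda>s. u s k) has_vector_derivative u' t k) (at t within {0..})"
      "\<And>t j. t \<ge> 0 \<Longrightarrow> (\<Sum>k\<in>stencil S j. of_real (mcoef S j k) * u' t k) +
             (\<Sum>k\<in>stencil S j. of_real (acoef S j k) * u t k) = 0"
    using u unfolding is_solution_def by blast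
  have "((\<lambda>s. c * u s (\<tau> k)) has_vector_derivative c * u' t (\<tau> k)) (at t within {0..})"
    if "t \<ge> 0" for t k
    by (rule has_vector_derivative_mult_right[OF u'(1)[OF that]])
  moreover have "(\<Sum>k\<in>stencil S j. of_real (mcoef S j k) * (c * u' t (\<tau> k))) +
             (\<Sum>k\<in>stencil S j. of_real (acoef S j k) * (c * u t (\<tau> k))) = 0" if "t \<ge> 0" for t j
  proof -
    have "(\<Sum>k\<in>stencil S j. of_real (mcoef S j k) * (c * u' t (\<tau> k))) +
             (\<Sum>k\<in>stencil S j. of_real (acoef S j k) * (c * u t (\<tau> k))) =
       c * ((\<Sum>k\<in>stencil S j. of_real (mcoef S j k) * u' t (\<tau> k)) +
             (\<Sum>k\<in>stencil S j. of_real (acoef S j k) * u t (\<tau> k)))"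
      by (simp add: distrib_left sum_distrib_left mult.left_commute)
    then show ?thesis
      using u'(2)[OF that, of "\<tau> j"]
      unfolding admissible_sum_translates(1)[OF S t, of j "u' t"] admissible_sum_translates(2)[OF S t, of j "u t"]
      by simp
  qed
  moreover have "u 0 = f" "\<forall>t\<ge>0. u t \<in> Vper X" using u by (auto simp: is_solution_def)
  ultimately show ?thesis
    unfolding is_solution_def
    by (intro conjI allI impI exI[of _ "\<lambda>t k. c * u' t (\<tau> k)"])
      (auto intro: Vper_translates[OF t])
qed

lemma solution_is_solution:
  assumes "uniquely_solvable X S" "f \<in> Vper X"
  shows "is_solution X S f (\<lambda>t. solution X S t f)"
proof -
  have "\<exists>u. is_solution X S f u" using assms unfolding uniquely_solvable_def by blast
  then show ?thesis unfolding solution_def by (rule someI_ex)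
qed

text \<open>
  Translating the solution and dividing by the multiplier gives another solution with the same
  datum, so uniqueness transfers the quasi-periodicity of the datum to all times.
\<close>

lemma solution_quasiperiodic:
  assumes S: "admissible_scheme X S" and us: "uniquely_solvable X S" and f: "f \<in> Vper X"
    and t: "translates X v \<tau>" and c: "c \<noteq> 0" and q: "\<And>j. f (\<tau> j) = c * f j" and "t \<ge> 0"
  shows "solution X S t f (\<tau> j) = c * solution X S t f j"
proof -
  have 1: "is_solution X S f (\<lambda>t. solution X S t f)" by (rule solution_is_solution[OF us f])
  have "is_solution X S f (\<lambda>t j. inverse c * solution X S t f (\<tau> j))"
    using is_solution_translates[OF S t 1, of "inverse c"] c by (simp add: q mult.assoc[symmetric])
  then have "(\<lambda>j. inverse c * solution X S t f (\<tau> j)) = solution X S t f"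
    using us f 1 \<open>t \<ge> 0\<close> unfolding uniquely_solvable_def by metis
  then have "inverse c * solution X S t f (\<tau> j) = solution X S t f j" by (rule fun_cong)
  then show ?thesis using c by (simp add: field_simps)
qed

section \<open>Plane waves on a scaled mesh\<close>

lemma proj_plane_wave_translates:
  assumes X: "periodic_mesh X" and h: "h > 0" and t: "translates X z \<sigma>"
  shows "proj P (scale_mesh h X) (plane_wave \<alpha>) (\<sigma> j) =
         plane_wave \<alpha> (h *\<^sub>R z) * proj P (scale_mesh h X) (plane_wave \<alpha>) j"
  by (simp add: proj_scale_mesh[OF X h] proj_translates[OF X t] scaleR_add_right plane_wave_add
      mult.commute[of _ "plane_wave \<alpha> (h *\<^sub>R z)"] proj_cmult)

lemma proj_plane_wave_Vper:
  assumes X: "periodic_mesh X" and h: "h > 0"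
  shows "proj P (scale_mesh h X) (plane_wave \<alpha>) \<in> Vper (scale_mesh h X)"
  unfolding Vper_def
proof (intro CollectI ballI allI impI)
  fix z \<sigma> j assume z: "z \<in> int_vectors" "translates (scale_mesh h X) z \<sigma>"
  have "translates X ((1 / h) *\<^sub>R z) \<sigma>"
    using translates_scale_mesh[of h X "(1 / h) *\<^sub>R z" \<sigma>] z(2) h by simp
  from proj_plane_wave_translates[OF X h this] show
    "proj P (scale_mesh h X) (plane_wave \<alpha>) (\<sigma> j) = proj P (scale_mesh h X) (plane_wave \<alpha>) j"
    using h plane_wave_int_vector[OF z(1)] by simp
qed

lemma proj_travelling_wave:
  "proj P X (\<lambda>x. plane_wave \<alpha> (x - t *\<^sub>R \<omega>)) j =
     exp (- of_real t * (2 * of_real pi * \<i> * linform \<alpha> \<omega>)) * proj P X (plane_wave \<alpha>) j"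
proof -
  have "plane_wave \<alpha> (x - t *\<^sub>R \<omega>) = exp (- of_real t * (2 * of_real pi * \<i> * linform \<alpha> \<omega>)) * plane_wave \<alpha> x" for x
    using plane_wave_add[of \<alpha> x "(- t) *\<^sub>R \<omega>"] plane_wave_scaleR[of \<alpha> "- t" \<omega>]
    by (simp add: mult_ac)
  then have "(\<lambda>x. plane_wave \<alpha> (x - t *\<^sub>R \<omega>)) =
      (\<lambda>x. exp (- of_real t * (2 * of_real pi * \<i> * linform \<alpha> \<omega>)) * plane_wave \<alpha> x)"
    by blast
  then show ?thesis by (simp only: proj_cmult)
qed

text \<open>
  The right-hand side is the residual of the projected travelling wave in the scheme on the scaled
  mesh at time 0, multiplied by \<open>h\<close>: the time derivative of the wave is multiplication by
  \<open>- 2 \<pi> i (\<alpha> \<cdot> \<omega>)\<close>.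
\<close>

lemma trunc_error_scaled_plane_wave:
  fixes P \<alpha>
  assumes X: "periodic_mesh X" and h: "h > 0"
  defines "f \<equiv> proj P (scale_mesh h X) (plane_wave \<alpha>)"
  shows "trunc_error P \<omega> X S (\<lambda>x. plane_wave \<alpha> (h *\<^sub>R x)) j =
    - (of_real h * (2 * of_real pi * \<i> * linform \<alpha> \<omega>)) * (\<Sum>k\<in>stencil S j. of_real (mcoef S j k) * f k) +
    (\<Sum>k\<in>stencil S j. of_real (acoef S j k) * f k)"
proof -
  have "frechet_derivative (\<lambda>x. plane_wave \<alpha> (h *\<^sub>R x)) (at x) \<omega> =
     (of_real h * (2 * of_real pi * \<i> * linform \<alpha> \<omega>)) * plane_wave \<alpha> (h *\<^sub>R x)" for x
    unfolding plane_wave_scaleR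
    by (subst C1_compose_linform(2)[OF DERIV_exp continuous_on_exp[OF continuous_on_id]])
      (simp add: mult_ac)
  then show ?thesis
    by (simp add: trunc_error_def f_def proj_scale_mesh[OF X h] proj_cmult sum_distrib_left mult_ac
        flip: sum_negf)
qed

section \<open>The mean truncation error is controlled by the solution error\<close>

lemma vector_mean_value_bound:
  fixes f :: "real \<Rightarrow> complex"
  assumes f: "\<And>t. t \<in> {0..1} \<Longrightarrow> (f has_vector_derivative f' t) (at t within {0..1})"
    and B: "\<And>t. t \<in> {0..1} \<Longrightarrow> cmod (f' t) \<le> B"
  shows "cmod (f 1 - f 0) \<le> B"
proof -
  have "norm (f 1 - f 0) \<le> B * norm (1 - 0 :: real)"
  proof (rule differentiable_bound[where S = "{0..1}" and f' = "\<lambda>t h. h *\<^sub>R f' t"])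
    show "(f has_derivative (\<lambda>h. h *\<^sub>R f' t)) (at t within {0..1})" if "t \<in> {0..1}" for t
      using f[OF that] by (simp add: has_vector_derivative_def)
    show "onorm (\<lambda>h. h *\<^sub>R f' t) \<le> B" if "t \<in> {0..1}" for t
    proof (rule onorm_le)
      fix h :: real
      show "norm (h *\<^sub>R f' t) \<le> B * norm h"
        using mult_left_mono[OF B[OF that], of "\<bar>h\<bar>"] by (simp add: mult.commute)
    qed
  qed auto
  then show ?thesis by simp
qed

text \<open>
  Conservation concerns \<open>X\<close>-periodic functions, whereas the solution error for a plane wave is only
  quasi-periodic. Over one period of \<open>X\<close>, however, the wave of frequency \<open>h \<alpha>\<close> is constant up
  to \<open>O(h)\<close>; dividing it out leaves a periodic function, whose mean flux balance is 0.
\<close>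

lemma flux_balance_of_quasiperiodic:
  fixes X :: "('j, 'd::finite) mesh"
  assumes X: "periodic_mesh X" and fv: "finite_volume_form X S F"
    and e: "\<And>z \<sigma> j. z \<in> int_vectors \<Longrightarrow> translates X z \<sigma> \<Longrightarrow> e (\<sigma> j) = plane_wave \<alpha> (h *\<^sub>R z) * e j"
    and h: "h > 0"
  shows "cmod (\<Sum>j\<in>period_indices X. of_real (vol X j) * (\<Sum>k\<in>stencil S j. of_real (acoef S j k) * e k))
     \<le> (\<Sum>j\<in>period_indices X. vol X j * (\<Sum>k\<in>stencil S j. \<bar>acoef S j k\<bar> * (h * (2 * pi * cmod (linform \<alpha> (point X k))) * cmod (e k))))"
proof -
  \<comment> \<open>Dividing by the wave sampled at the mesh points makes \<open>e\<close> periodic.\<close>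
  define v where "v k = plane_wave \<alpha> (- (h *\<^sub>R point X k)) * e k" for k
  have "v \<in> Vper X"
    unfolding Vper_def
  proof (intro CollectI ballI allI impI)
    fix z \<sigma> j assume z: "z \<in> int_vectors" "translates X z \<sigma>"
    have "plane_wave \<alpha> (- (h *\<^sub>R point X (\<sigma> j))) * plane_wave \<alpha> (h *\<^sub>R z) = plane_wave \<alpha> (- (h *\<^sub>R point X j))"
      by (simp add: translates_point[OF z(2)] scaleR_add_right flip: plane_wave_add)
    then show "v (\<sigma> j) = v j" unfolding v_def e[OF z] by (simp only: mult.assoc[symmetric])
  qed
  then have v0: "(\<Sum>j\<in>period_indices X. of_real (vol X j) * (\<Sum>k\<in>stencil S j. of_real (acoef S j k) * v k)) = 0"
    by (rule finite_volume_conservation[OF X fv])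
  have ev: "cmod (e k - v k) \<le> h * (2 * pi * cmod (linform \<alpha> (point X k))) * cmod (e k)" for k
  proof -
    let ?z = "2 * of_real pi * \<i> * of_real (- h) * linform \<alpha> (point X k)"
    have w: "plane_wave \<alpha> (- (h *\<^sub>R point X k)) = exp ?z"
      using plane_wave_scaleR[of \<alpha> "- h" "point X k"] by simp
    have "cmod (exp ?z - 1) \<le> cmod ?z"
      using cmod_exp_remainder_le[OF Re_wave_phase, of 0 "- h" \<alpha> "point X k"] by (simp add: exp_remainder_def)
    also have "cmod ?z = h * (2 * pi * cmod (linform \<alpha> (point X k)))"
      using h by (simp add: norm_mult)
    finally have b: "cmod (exp ?z - 1) \<le> h * (2 * pi * cmod (linform \<alpha> (point X k)))" .
    have "e k - v k = - ((exp ?z - 1) * e k)" unfolding v_def w by (simp only: left_diff_distrib) simp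
    then have "cmod (e k - v k) = cmod (exp ?z - 1) * cmod (e k)"
      by (simp only: norm_minus_cancel norm_mult)
    then show ?thesis using mult_right_mono[OF b norm_ge_zero[of "e k"]] by simp
  qed
  have "(\<Sum>j\<in>period_indices X. of_real (vol X j) * (\<Sum>k\<in>stencil S j. of_real (acoef S j k) * e k)) =
      (\<Sum>j\<in>period_indices X. of_real (vol X j) * (\<Sum>k\<in>stencil S j. of_real (acoef S j k) * (e k - v k)))"
    using v0 by (simp add: right_diff_distrib sum_subtractf)
  also have "cmod \<dots> \<le> (\<Sum>j\<in>period_indices X. vol X j * (\<Sum>k\<in>stencil S j. \<bar>acoef S j k\<bar> * (h * (2 * pi * cmod (linform \<alpha> (point X k))) * cmod (e k))))"
  proof (rule sum_norm_le)
    fix j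
    have "cmod (\<Sum>k\<in>stencil S j. of_real (acoef S j k) * (e k - v k)) \<le>
       (\<Sum>k\<in>stencil S j. \<bar>acoef S j k\<bar> * (h * (2 * pi * cmod (linform \<alpha> (point X k))) * cmod (e k)))"
      by (rule sum_norm_le) (simp only: norm_mult norm_of_real, rule mult_left_mono[OF ev abs_ge_zero])
    then show "cmod (of_real (vol X j) * (\<Sum>k\<in>stencil S j. of_real (acoef S j k) * (e k - v k))) \<le>
       vol X j * (\<Sum>k\<in>stencil S j. \<bar>acoef S j k\<bar> * (h * (2 * pi * cmod (linform \<alpha> (point X k))) * cmod (e k)))"
      using vol_pos[OF X, of j] by (simp add: norm_mult mult_left_mono)
  qed
  finally show ?thesis .
qed

text \<open>
  The solution error \<open>e\<close> satisfies \<open>M e' + A e / h = - E T / h\<close> with \<open>E\<close> of modulus 1 and \<open>T\<close> the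
  truncation error of the wave at scale \<open>h\<close>. In the mean over a period of \<open>X\<close> the term \<open>A e / h\<close>
  is bounded by \<open>e\<close> itself, with no negative power of \<open>h\<close>, so that \<open>T / h\<close> can only be
  balanced by the change of the mean of \<open>M e\<close> over a unit of time, which is of the size of \<open>e\<close>. The
  constant \<open>K\<close> does not depend on \<open>h\<close>.
\<close>

lemma mean_truncation_error_bound:
  fixes X :: "('j, 'd::finite) mesh"
  assumes X: "periodic_mesh X" and S: "admissible_scheme X S" and fv: "finite_volume_form X S F"
  shows "\<exists>K. \<forall>h\<in>scalings. \<forall>\<eta>\<ge>0.
    uniquely_solvable (scale_mesh h X) (scale_scheme h S) \<longrightarrow>
    (\<forall>t\<in>{0<..1}. mesh_norm (scale_mesh h X)
       (sol_error P \<omega> (scale_mesh h X) (scale_scheme h S) (plane_wave \<alpha>) t) \<le> \<eta>) \<longrightarrow>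
    cmod (\<Sum>j\<in>period_indices X. of_real (vol X j) * trunc_error P \<omega> X S (\<lambda>x. plane_wave \<alpha> (h *\<^sub>R x)) j)
      \<le> K * h * \<eta>"
proof -
  let ?R = "period_indices X"
  define \<kappa> where "\<kappa> = 2 * of_real pi * \<i> * linform \<alpha> \<omega>"
  \<comment> \<open>\<open>1 / sqrt (vol X k)\<close> converts the mesh norm of the error into a bound for its value at \<open>k\<close>.\<close>
  define KM where "KM = (\<Sum>j\<in>?R. vol X j * (\<Sum>k\<in>stencil S j. \<bar>mcoef S j k\<bar> * (1 / sqrt (vol X k))))"
  define KA where "KA = (\<Sum>j\<in>?R. vol X j * (\<Sum>k\<in>stencil S j.
      \<bar>acoef S j k\<bar> * (2 * pi * cmod (linform \<alpha> (point X k)) * (1 / sqrt (vol X k)))))"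
  have "cmod (\<Sum>j\<in>?R. of_real (vol X j) * trunc_error P \<omega> X S (\<lambda>x. plane_wave \<alpha> (h *\<^sub>R x)) j)
      \<le> (cmod \<kappa> * KM + KA + KM) * h * \<eta>"
    if h: "h \<in> scalings" and \<eta>: "\<eta> \<ge> 0"
      and us: "uniquely_solvable (scale_mesh h X) (scale_scheme h S)"
      and le: "\<And>t. t \<in> {0<..1} \<Longrightarrow> mesh_norm (scale_mesh h X)
       (sol_error P \<omega> (scale_mesh h X) (scale_scheme h S) (plane_wave \<alpha>) t) \<le> \<eta>"
    for h \<eta>
  proof -
    have hp: "h > 0" using scalingsD h by blast
    let ?Y = "scale_mesh h X"
    let ?Sh = "scale_scheme h S"
    define f where "f = proj P ?Y (plane_wave \<alpha>)"
    define u where "u t = solution ?Y ?Sh t f" for t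
    define e where "e t = sol_error P \<omega> ?Y ?Sh (plane_wave \<alpha>) t" for t
    define E where "E t = exp (- of_real t * \<kappa>)" for t :: real
    have f: "f \<in> Vper ?Y" unfolding f_def by (rule proj_plane_wave_Vper[OF X hp])
    have Sh: "admissible_scheme ?Y ?Sh" by (rule admissible_scale[OF S hp])
    have e_eq: "e t k = u t k - E t * f k" for t k
      by (simp add: e_def sol_error_def u_def f_def E_def \<kappa>_def proj_travelling_wave[of _ _ _ t])
    have sol: "is_solution ?Y ?Sh f u" unfolding u_def by (rule solution_is_solution[OF us f])
    have e0: "e 0 k = 0" for k using sol by (simp add: e_eq E_def is_solution_def)
    obtain u' where u': "\<And>t k. t \<ge> 0 \<Longrightarrow> ((\<lambda>s. u s k) has_vector_derivative u' t k) (at t within {0..})"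
      "\<And>t j. t \<ge> 0 \<Longrightarrow> (\<Sum>k\<in>stencil S j. of_real (mcoef S j k) * u' t k) +
             (\<Sum>k\<in>stencil S j. of_real (acoef S j k / h) * u t k) = 0"
      using sol unfolding is_solution_def scale_scheme_simps by blast
    have quasi: "e t (\<sigma> j) = plane_wave \<alpha> (h *\<^sub>R z) * e t j"
      if "z \<in> int_vectors" "translates X z \<sigma>" "t \<ge> 0" for z \<sigma> j t
    proof -
      have f\<sigma>: "f (\<sigma> j) = plane_wave \<alpha> (h *\<^sub>R z) * f j" for j
        unfolding f_def by (rule proj_plane_wave_translates[OF X hp that(2)])
      have "translates ?Y (h *\<^sub>R z) \<sigma>" using translates_scale_mesh[of h X z \<sigma>] that(2) hp by simp
      from solution_quasiperiodic[OF Sh us f this plane_wave_nonzero f\<sigma> that(3)]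
      show ?thesis by (simp add: e_eq u_def f\<sigma> algebra_simps)
    qed
    have small: "cmod (e t k) \<le> 1 / sqrt (vol X k) * \<eta>" if t: "t \<in> {0..1}" for t k
    proof (cases "t = 0")
      case True
      then show ?thesis using \<eta> vol_pos[OF X, of k] by (simp add: e0)
    next
      case False
      with t have t: "t \<in> {0<..1}" by auto
      have "vol X k * (cmod (e t k))\<^sup>2 \<le> (mesh_norm ?Y (e t))\<^sup>2"
        by (rule cmod_le_mesh_norm[OF X h]) (use quasi t in \<open>simp add: norm_mult\<close>)
      also have "\<dots> \<le> \<eta>\<^sup>2"
        using le[OF t] unfolding e_def[symmetric]
        by (intro power_mono) (auto simp: mesh_norm_def vol_pos[OF periodic_scale_mesh[OF X h]] less_imp_le
            intro!: sum_nonneg mult_nonneg_nonneg)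
      finally have "(sqrt (vol X k) * cmod (e t k))\<^sup>2 \<le> \<eta>\<^sup>2"
        using vol_pos[OF X, of k] by (simp add: power_mult_distrib)
      then have "sqrt (vol X k) * cmod (e t k) \<le> \<eta>" using \<eta> by (rule power2_le_imp_le)
      then show ?thesis using vol_pos[OF X, of k] by (simp add: field_simps)
    qed
    define T where "T = (\<Sum>j\<in>?R. of_real (vol X j) * trunc_error P \<omega> X S (\<lambda>x. plane_wave \<alpha> (h *\<^sub>R x)) j)"
    define Q where "Q t = (\<Sum>j\<in>?R. of_real (vol X j) * (\<Sum>k\<in>stencil S j. of_real (mcoef S j k) * e t k))" for t
    define A where "A t = (\<Sum>j\<in>?R. of_real (vol X j) * (\<Sum>k\<in>stencil S j. of_real (acoef S j k) * e t k))" for t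
    have Re: "Re \<kappa> = 0" by (simp add: \<kappa>_def linform_of_real)
    have Q_le: "cmod (Q t) \<le> KM * \<eta>" if t: "t \<in> {0..1}" for t
      unfolding Q_def KM_def sum_distrib_right
    proof (rule sum_norm_le)
      fix j
      have "cmod (\<Sum>k\<in>stencil S j. of_real (mcoef S j k) * e t k) \<le>
          (\<Sum>k\<in>stencil S j. \<bar>mcoef S j k\<bar> * (1 / sqrt (vol X k) * \<eta>))"
        by (rule sum_norm_le) (simp only: norm_mult norm_of_real, rule mult_left_mono[OF small[OF t] abs_ge_zero])
      also have "\<dots> = (\<Sum>k\<in>stencil S j. \<bar>mcoef S j k\<bar> * (1 / sqrt (vol X k))) * \<eta>"
        by (simp only: sum_distrib_right mult.assoc)
      finally show "cmod (of_real (vol X j) * (\<Sum>k\<in>stencil S j. of_real (mcoef S j k) * e t k)) \<le>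
          vol X j * (\<Sum>k\<in>stencil S j. \<bar>mcoef S j k\<bar> * (1 / sqrt (vol X k))) * \<eta>"
        using vol_pos[OF X, of j] by (simp only: norm_mult norm_of_real abs_of_pos mult.assoc mult_left_mono less_imp_le)
    qed
    have A_le: "cmod (A t) \<le> h * (KA * \<eta>)" if t: "t \<in> {0..1}" for t
    proof -
      have t0: "t \<ge> 0" using t by simp
      have "cmod (A t) \<le> (\<Sum>j\<in>?R. vol X j * (\<Sum>k\<in>stencil S j. \<bar>acoef S j k\<bar> *
          (h * (2 * pi * cmod (linform \<alpha> (point X k))) * cmod (e t k))))"
        unfolding A_def by (rule flux_balance_of_quasiperiodic[OF X fv quasi[OF _ _ t0] hp])
      also have "\<dots> \<le> (\<Sum>j\<in>?R. vol X j * (\<Sum>k\<in>stencil S j. \<bar>acoef S j k\<bar> *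
          (h * (2 * pi * cmod (linform \<alpha> (point X k))) * (1 / sqrt (vol X k) * \<eta>))))"
        using hp less_imp_le[OF vol_pos[OF X]]
        by (intro sum_mono mult_left_mono small[OF t] sum_nonneg mult_nonneg_nonneg) auto
      also have "\<dots> = h * (KA * \<eta>)"
        unfolding KA_def sum_distrib_left sum_distrib_right by (intro sum.cong refl) (simp add: mult_ac)
      finally show ?thesis .
    qed
    have e': "((\<lambda>s. e s k) has_vector_derivative u' t k + \<kappa> * E t * f k) (at t within {0..})" if "t \<ge> 0" for t k
    proof -
      have "(E has_vector_derivative - \<kappa> * E t) (at t within {0..})"
      proof -
        have "((\<lambda>z. exp (- z * \<kappa>)) has_field_derivative - \<kappa> * exp (- of_real t * \<kappa>)) (at (of_real t))"
          by (auto intro!: derivative_eq_intros)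
        then have "((\<lambda>s. exp (- of_real s * \<kappa>)) has_vector_derivative - \<kappa> * exp (- of_real t * \<kappa>)) (at t within {0..})"
          by (rule has_vector_derivative_real_field)
        then show ?thesis by (simp add: E_def[abs_def])
      qed
      from has_vector_derivative_diff[OF u'(1)[OF that, of k] has_vector_derivative_mult_left[OF this, of "f k"]]
      show ?thesis by (simp add: e_eq mult.assoc)
    qed
    define Q' where "Q' t = (\<Sum>j\<in>?R. of_real (vol X j) *
        (\<Sum>k\<in>stencil S j. of_real (mcoef S j k) * (u' t k + \<kappa> * E t * f k)))" for t
    have Q': "(Q has_vector_derivative Q' t) (at t within {0..1})" if t: "t \<in> {0..1}" for t
    proof -
      have "((\<lambda>s. e s k) has_vector_derivative u' t k + \<kappa> * E t * f k) (at t within {0..1})" for k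
        by (rule has_vector_derivative_within_subset[OF e']) (use t in auto)
      then show ?thesis
        unfolding Q_def[abs_def] Q'_def
        by (intro has_vector_derivative_sum has_vector_derivative_mult_right)
    qed
    have Q'_eq: "Q' t = - (A t / of_real h) - E t / of_real h * T" if t: "t \<in> {0..1}" for t
    proof -
      have "(\<Sum>k\<in>stencil S j. of_real (mcoef S j k) * (u' t k + \<kappa> * E t * f k)) =
         - ((\<Sum>k\<in>stencil S j. of_real (acoef S j k) * e t k) / of_real h)
         - E t / of_real h * trunc_error P \<omega> X S (\<lambda>x. plane_wave \<alpha> (h *\<^sub>R x)) j" for j
      proof -
        define su where "su = (\<Sum>k\<in>stencil S j. of_real (acoef S j k) * u t k)"
        define sf where "sf = (\<Sum>k\<in>stencil S j. of_real (acoef S j k) * f k)"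
        define mf where "mf = (\<Sum>k\<in>stencil S j. of_real (mcoef S j k) * f k)"
        define mu where "mu = (\<Sum>k\<in>stencil S j. of_real (mcoef S j k) * u' t k)"
        have 1: "mu + su / of_real h = 0"
          using u'(2)[of t j] t by (simp add: mu_def su_def sum_divide_distrib)
        have 2: "(\<Sum>k\<in>stencil S j. of_real (mcoef S j k) * (u' t k + \<kappa> * E t * f k)) = mu + \<kappa> * E t * mf"
          by (simp add: mu_def mf_def distrib_left sum.distrib sum_distrib_left mult_ac)
        have 3: "(\<Sum>k\<in>stencil S j. of_real (acoef S j k) * e t k) = su - E t * sf"
          by (simp add: e_eq su_def sf_def right_diff_distrib sum_subtractf sum_distrib_left mult_ac)
        have 4: "trunc_error P \<omega> X S (\<lambda>x. plane_wave \<alpha> (h *\<^sub>R x)) j = - (of_real h * \<kappa>) * mf + sf"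
          unfolding mf_def sf_def f_def \<kappa>_def by (rule trunc_error_scaled_plane_wave[OF X hp])
        have 5: "mu = - (su / of_real h)" using 1 by (simp add: eq_neg_iff_add_eq_0)
        show ?thesis unfolding 2 3 4 5 using hp by (simp add: field_simps)
      qed
      then show ?thesis
        unfolding Q'_def A_def T_def
        by (simp add: right_diff_distrib sum_subtractf sum_distrib_left sum_divide_distrib mult_ac flip: sum_negf)
    qed
    define G where "G t = exp (of_real t * \<kappa>)" for t :: real
    have GE: "G t * E t = 1" for t by (simp add: G_def E_def flip: exp_add)
    have G1: "cmod (G t) = 1" for t using Re by (simp add: G_def)
    \<comment> \<open>The factor \<open>G\<close> undoes the oscillation of the right-hand side, so that its contribution grows
      linearly in time even when the wave returns to its initial state.\<close>
    define H where "H t = G t * Q t + of_real t * (T / of_real h)" for t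
    define H' where "H' t = G t * (\<kappa> * Q t - A t / of_real h)" for t
    have "cmod (H 1 - H 0) \<le> (cmod \<kappa> * KM + KA) * \<eta>"
    proof (rule vector_mean_value_bound)
      fix t :: real assume t: "t \<in> {0..1}"
      have dG: "(G has_vector_derivative \<kappa> * G t) (at t within {0..1})"
      proof -
        have "((\<lambda>z. exp (z * \<kappa>)) has_field_derivative \<kappa> * exp (of_real t * \<kappa>)) (at (of_real t))"
          by (auto intro!: derivative_eq_intros)
        then have "((\<lambda>s. exp (of_real s * \<kappa>)) has_vector_derivative \<kappa> * exp (of_real t * \<kappa>)) (at t within {0..1})"
          by (rule has_vector_derivative_real_field)
        then show ?thesis by (simp add: G_def[abs_def])
      qed
      have dt: "((\<lambda>t. of_real t * (T / of_real h)) has_vector_derivative 1 * (T / of_real h)) (at t within {0..1})"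
        by (intro has_vector_derivative_mult_left has_vector_derivative_of_real derivative_eq_intros) auto
      have "(H has_vector_derivative (G t * Q' t + \<kappa> * G t * Q t) + 1 * (T / of_real h)) (at t within {0..1})"
        unfolding H_def[abs_def]
        by (intro has_vector_derivative_add has_vector_derivative_mult dG Q'[OF t] dt)
      also have "(G t * Q' t + \<kappa> * G t * Q t) + 1 * (T / of_real h) =
          H' t + (1 - G t * E t) * (T / of_real h)"
        unfolding Q'_eq[OF t] H'_def using hp by (simp add: field_simps)
      also have "\<dots> = H' t" by (simp add: GE)
      finally show "(H has_vector_derivative H' t) (at t within {0..1})" .
      have "cmod (H' t) = cmod (\<kappa> * Q t - A t / of_real h)"
        unfolding H'_def by (simp only: norm_mult[of "G t"] G1 mult_1)
      also have "\<dots> \<le> cmod (\<kappa> * Q t) + cmod (A t / of_real h)" by (rule norm_triangle_ineq4)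
      also have "\<dots> \<le> cmod \<kappa> * (KM * \<eta>) + KA * \<eta>"
      proof (rule add_mono)
        show "cmod (\<kappa> * Q t) \<le> cmod \<kappa> * (KM * \<eta>)"
          unfolding norm_mult by (rule mult_left_mono[OF Q_le[OF t] norm_ge_zero])
        show "cmod (A t / of_real h) \<le> KA * \<eta>"
          using A_le[OF t] hp by (simp add: norm_divide divide_le_eq mult_ac)
      qed
      finally show "cmod (H' t) \<le> (cmod \<kappa> * KM + KA) * \<eta>" by (simp add: algebra_simps)
    qed
    moreover have "H 0 = 0" by (simp add: H_def Q_def e0)
    moreover have "H 1 = G 1 * Q 1 + T / of_real h" by (simp add: H_def)
    ultimately have "cmod (G 1 * Q 1 + T / of_real h) \<le> (cmod \<kappa> * KM + KA) * \<eta>" by simp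
    moreover have "cmod (T / of_real h) \<le> cmod (G 1 * Q 1 + T / of_real h) + cmod (G 1 * Q 1)"
      using norm_triangle_ineq4[of "G 1 * Q 1 + T / of_real h" "G 1 * Q 1"] by simp
    moreover have "cmod (G 1 * Q 1) \<le> KM * \<eta>" using Q_le[of 1] by (simp add: norm_mult G1)
    ultimately have "cmod (T / of_real h) \<le> (cmod \<kappa> * KM + KA + KM) * \<eta>" by (simp add: algebra_simps)
    then have "cmod T \<le> (cmod \<kappa> * KM + KA + KM) * \<eta> * h" using hp by (simp add: norm_divide divide_le_eq)
    then show ?thesis unfolding T_def by (simp only: mult_ac)
  qed
  then show ?thesis by blast
qed

section \<open>Limited order of accuracy\<close>

theorem mainTheorem2:
  fixes X :: "('j, 'd::finite) mesh"
    and S :: "'j scheme"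
    and F :: "'j \<Rightarrow> 'j \<Rightarrow> ('j \<Rightarrow> complex) \<Rightarrow> complex"
    and P :: projection
    and \<omega> :: "real ^ 'd"
    and p :: nat
  assumes "periodic_mesh X"
    and "admissible_scheme X S"
    and "finite_volume_form X S F"
    and "\<forall>h \<in> scalings. uniquely_solvable (scale_mesh h X) (scale_scheme h S)"
    and "stable_family X S"
    and "p_exact p P \<omega> X S"
    and "\<not> zero_mean_error (p + 1) P \<omega> X S"
  shows "\<exists>\<alpha> :: int ^ 'd. \<forall>\<delta>>0. \<forall>C>0. \<exists>h \<in> scalings. \<exists>t>0.
           \<not> mesh_norm (scale_mesh h X)
                (sol_error P \<omega> (scale_mesh h X) (scale_scheme h S) (plane_wave \<alpha>) t)
              \<le> C * h powr (real p + \<delta>) * (1 + t)"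
proof -
  note X = assms(1) and p = assms(6)
  let ?R = "period_indices X"
  define L where "L f = (\<Sum>j\<in>?R. of_real (vol X j) * trunc_error P \<omega> X S f j)" for f
  have L: "C1_linear \<omega> L"
    unfolding L_def[abs_def]
    by (rule C1_linear_combination[OF finite_period_indices[OF X] C1_linear_trunc_error[OF X]])
  have "L (cmonom e) = 0" if "(\<Sum>i\<in>UNIV. e i) \<le> p" for e
    using p cmonom_in_polys[OF that] by (simp add: L_def p_exact_def)
  moreover obtain f where "f \<in> polys (Suc p)" "L f \<noteq> 0"
    using assms(7) by (auto simp: zero_mean_error_def L_def)
  ultimately obtain \<alpha> where \<alpha>: "L (\<lambda>x. linform \<alpha> x ^ Suc p) \<noteq> 0"
    using exists_wave_direction[OF L] by blast
  define c0 where "c0 = (2 * pi) ^ Suc p / fact (Suc p) * cmod (L (\<lambda>x. linform \<alpha> x ^ Suc p))"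
  have c0: "c0 > 0" using \<alpha> by (simp add: c0_def)
  obtain CT where CT: "\<And>s. s \<ge> 0 \<Longrightarrow> cmod (L (\<lambda>x. plane_wave \<alpha> (s *\<^sub>R x)) -
      (2 * of_real pi * \<i> * of_real s) ^ Suc p / fact (Suc p) * L (\<lambda>x. linform \<alpha> x ^ Suc p)) \<le> CT * s ^ (p + 2)"
    using sum_trunc_error_plane_wave[OF X p _ finite_period_indices[OF X], of \<alpha>] assms(2)
    unfolding L_def admissible_scheme_def by blast
  obtain K where K: "\<And>h \<eta>. h \<in> scalings \<Longrightarrow> \<eta> \<ge> 0 \<Longrightarrow>
    (\<And>t. t \<in> {0<..1} \<Longrightarrow> mesh_norm (scale_mesh h X)
       (sol_error P \<omega> (scale_mesh h X) (scale_scheme h S) (plane_wave \<alpha>) t) \<le> \<eta>) \<Longrightarrow>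
    cmod (L (\<lambda>x. plane_wave \<alpha> (h *\<^sub>R x))) \<le> K * h * \<eta>"
    using mean_truncation_error_bound[OF X assms(2,3), of P \<omega> \<alpha>] assms(4) unfolding L_def by blast
  show ?thesis
  proof (intro exI[of _ \<alpha>] allI impI, rule ccontr)
    fix \<delta> C :: real assume \<delta>: "\<delta> > 0" and C: "C > 0"
    assume "\<not> (\<exists>h\<in>scalings. \<exists>t>0. \<not> mesh_norm (scale_mesh h X)
                (sol_error P \<omega> (scale_mesh h X) (scale_scheme h S) (plane_wave \<alpha>) t)
              \<le> C * h powr (real p + \<delta>) * (1 + t))"
    then have le: "mesh_norm (scale_mesh h X)
                (sol_error P \<omega> (scale_mesh h X) (scale_scheme h S) (plane_wave \<alpha>) t)
              \<le> C * h powr (real p + \<delta>) * (1 + t)" if "h \<in> scalings" "t > 0" for h t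
      using that by blast
    \<comment> \<open>Dividing by \<open>h ^ Suc p\<close> leaves a positive constant below a quantity that tends to 0.\<close>
    have main: "c0 \<le> CT * h + 2 * K * C * h powr \<delta>" if h: "h \<in> scalings" for h
    proof -
      have hp: "h > 0" using scalingsD h by blast
      define \<eta> where "\<eta> = 2 * C * h powr (real p + \<delta>)"
      have \<eta>0: "\<eta> \<ge> 0" using C by (simp add: \<eta>_def)
      have "cmod (L (\<lambda>x. plane_wave \<alpha> (h *\<^sub>R x))) \<le> K * h * \<eta>"
      proof (rule K[OF h \<eta>0])
        fix t :: real assume t: "t \<in> {0<..1}"
        have "C * h powr (real p + \<delta>) * (1 + t) \<le> C * h powr (real p + \<delta>) * 2"
          using t C by (intro mult_left_mono) auto
        then show "mesh_norm (scale_mesh h X)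
            (sol_error P \<omega> (scale_mesh h X) (scale_scheme h S) (plane_wave \<alpha>) t) \<le> \<eta>"
          using le[OF h, of t] t by (simp add: \<eta>_def)
      qed
      moreover have "cmod ((2 * of_real pi * \<i> * of_real h) ^ Suc p / fact (Suc p) * L (\<lambda>x. linform \<alpha> x ^ Suc p)) = c0 * h ^ Suc p"
        using hp by (simp add: c0_def norm_mult norm_divide norm_power power_mult_distrib del: fact_Suc)
      moreover have "cmod ((2 * of_real pi * \<i> * of_real h) ^ Suc p / fact (Suc p) * L (\<lambda>x. linform \<alpha> x ^ Suc p))
         \<le> cmod (L (\<lambda>x. plane_wave \<alpha> (h *\<^sub>R x))) + CT * h ^ (p + 2)"
        using CT[of h] hp norm_triangle_ineq3[of "L (\<lambda>x. plane_wave \<alpha> (h *\<^sub>R x))"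
          "(2 * of_real pi * \<i> * of_real h) ^ Suc p / fact (Suc p) * L (\<lambda>x. linform \<alpha> x ^ Suc p)"]
        by linarith
      ultimately have "c0 * h ^ Suc p \<le> K * h * \<eta> + CT * h ^ (p + 2)" by linarith
      also have "K * h * \<eta> = 2 * K * C * h powr \<delta> * h ^ Suc p"
        using hp by (simp add: \<eta>_def powr_add powr_realpow mult_ac)
      also have "2 * K * C * h powr \<delta> * h ^ Suc p + CT * h ^ (p + 2) =
          (CT * h + 2 * K * C * h powr \<delta>) * h ^ Suc p"
        by (simp add: algebra_simps)
      finally show ?thesis using hp by (simp del: power_Suc)
    qed
    have sc: "1 / real (Suc n) \<in> scalings" for n
      by (simp add: scalings_def del: of_nat_Suc)
    have inv: "(\<lambda>n. 1 / real (Suc n)) \<longlonglongrightarrow> 0" by (rule LIMSEQ_Suc[OF lim_1_over_n])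
    have "(\<lambda>n. CT * (1 / real (Suc n)) + 2 * K * C * (1 / real (Suc n)) powr \<delta>)
        \<longlonglongrightarrow> CT * 0 + 2 * K * C * 0 powr \<delta>"
      using \<delta> by (intro tendsto_add tendsto_mult tendsto_const inv tendsto_powr2) auto
    then have "c0 \<le> CT * 0 + 2 * K * C * 0 powr \<delta>"
      using main[OF sc] by (intro tendsto_lowerbound[OF _ _ sequentially_bot]) auto
    then show False using c0 by simp
  qed
qed

end
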